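(* For each integer $s\geq 1$ there exists an infinite family $(\Gamma_k)_{k\ge 1}$ of pairwise non-isomorphic graphs whose proportions of good vertices satisfy $$\lim_{k\to\infty}\frac{|K(\Gamma_k)|}{|V(\Gamma_k)|}=\frac{s+1}{2s+1}.$$ In particular, for $s=1$ this limit equals $2/3$.
   Context: All graphs are finite, simple, undirected and connected. For vertices $a,b$ of a connected graph $G$, the resistance distance $\Omega_G(a,b)$ is the effective resistance between $a$ and $b$ in the electrical network obtained from $G$ by replacing each edge by a unit resistor; equivalently $\Omega_G(a,b)=(e_a-e_b)^{T}L^{\dagger}(e_a-e_b)$, where $L$ is the Laplacian matrix of $G$, $L^{\dagger}$ its Moore–Penrose inverse, and $e_a$ the standard unit vector indexed by $a$. The Kirchhoff index of a connected graph $G$ is $Kf(G)=\sum_{\{u,w\}\subseteq V(G)}\Omega_G(u,w)$, the sum over unordered pairs of distinct vertices. $G-v$ denotes the graph obtained from $G$ by deleting the vertex $v$ and its incident edges. A vertex $v$ of $G$ is good if $G-v$ is connected and $Kf(G)=Kf(G-v)$ (cut vertices are not good). $K(G)$ denotes the set of good vertices of $G$. *)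

theory Defs
  imports Complex_Main "Graph_Theory.Graph_Theory"
begin

text \<open>
  A finite simple undirected graph is a finite symmetric digraph without loops and parallel arcs
  (locale \<^locale>\<open>graph\<close>): an undirected edge is a pair of opposite arcs.  Matrices indexed by a
  finite vertex set \<open>V\<close> are functions \<open>'a \<Rightarrow> 'a \<Rightarrow> real\<close>, of which only the values on
  \<open>V \<times> V\<close> matter.
\<close>

definition mat_prod :: "'a set \<Rightarrow> ('a \<Rightarrow> 'a \<Rightarrow> real) \<Rightarrow> ('a \<Rightarrow> 'a \<Rightarrow> real) \<Rightarrow> 'a \<Rightarrow> 'a \<Rightarrow> real" where
  "mat_prod V A B i j = (\<Sum>k\<in>V. A i k * B k j)"

text \<open>
  The four Penrose conditions for real matrices.  The last conjunct makes \<open>X\<close> vanish outside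
  \<open>V \<times> V\<close>, so that it is unique as a function.
\<close>
definition is_moore_penrose :: "'a set \<Rightarrow> ('a \<Rightarrow> 'a \<Rightarrow> real) \<Rightarrow> ('a \<Rightarrow> 'a \<Rightarrow> real) \<Rightarrow> bool" where
  "is_moore_penrose V A X \<longleftrightarrow>
     (\<forall>i\<in>V. \<forall>j\<in>V. mat_prod V (mat_prod V A X) A i j = A i j) \<and>
     (\<forall>i\<in>V. \<forall>j\<in>V. mat_prod V (mat_prod V X A) X i j = X i j) \<and>
     (\<forall>i\<in>V. \<forall>j\<in>V. mat_prod V A X i j = mat_prod V A X j i) \<and>
     (\<forall>i\<in>V. \<forall>j\<in>V. mat_prod V X A i j = mat_prod V X A j i) \<and>
     (\<forall>i j. (i, j) \<notin> V \<times> V \<longrightarrow> X i j = 0)"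

definition moore_penrose :: "'a set \<Rightarrow> ('a \<Rightarrow> 'a \<Rightarrow> real) \<Rightarrow> 'a \<Rightarrow> 'a \<Rightarrow> real" where
  "moore_penrose V A = (THE X. is_moore_penrose V A X)"

lemma mat_prod_assoc:
  "mat_prod V (mat_prod V A B) C i j = mat_prod V A (mat_prod V B C) i j"
  unfolding mat_prod_def sum_distrib_left sum_distrib_right
  by (subst sum.swap) (simp add: mult.assoc)

lemma is_moore_penrose_unique:
  assumes X: "is_moore_penrose V A X" and Y: "is_moore_penrose V A Y"
  shows "X = Y"
proof -
  have cong: "mat_prod V B C i j = mat_prod V B' C' i j"
    if "\<And>k. k \<in> V \<Longrightarrow> B i k = B' i k" "\<And>k. k \<in> V \<Longrightarrow> C k j = C' k j" for B C B' C' i j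
    unfolding mat_prod_def using that by (intro sum.cong) auto
  have transp: "mat_prod V B C i j = mat_prod V (\<lambda>p q. C q p) (\<lambda>p q. B q p) j i" for B C i j
    by (simp add: mat_prod_def mult.commute)
  note XD = X[unfolded is_moore_penrose_def] and YD = Y[unfolded is_moore_penrose_def]
  have AX_AY: "mat_prod V A X i j = mat_prod V A Y i j" if "i \<in> V" "j \<in> V" for i j
  proof -
    have "mat_prod V A X i j = mat_prod V (mat_prod V (mat_prod V A Y) A) X i j"
      by (rule cong) (use YD that in auto)
    also have "\<dots> = mat_prod V (mat_prod V A Y) (mat_prod V A X) i j"
      by (rule mat_prod_assoc)
    also have "\<dots> = mat_prod V (\<lambda>p q. mat_prod V A Y q p) (\<lambda>p q. mat_prod V A X q p) i j"
      by (rule cong) (use XD YD that in auto)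
    also have "\<dots> = mat_prod V (mat_prod V A X) (mat_prod V A Y) j i"
      by (rule transp[symmetric])
    also have "\<dots> = mat_prod V (mat_prod V (mat_prod V A X) A) Y j i"
      by (rule mat_prod_assoc[symmetric])
    also have "\<dots> = mat_prod V A Y j i"
      by (rule cong) (use XD that in auto)
    finally show ?thesis using YD that by auto
  qed
  have XA_YA: "mat_prod V X A i j = mat_prod V Y A i j" if "i \<in> V" "j \<in> V" for i j
  proof -
    have "mat_prod V X A i j = mat_prod V X (mat_prod V (mat_prod V A Y) A) i j"
      by (rule cong) (use YD that in auto)
    also have "\<dots> = mat_prod V X (mat_prod V A (mat_prod V Y A)) i j"
      by (rule cong) (simp_all add: mat_prod_assoc)
    also have "\<dots> = mat_prod V (mat_prod V X A) (mat_prod V Y A) i j"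
      by (rule mat_prod_assoc[symmetric])
    also have "\<dots> = mat_prod V (\<lambda>p q. mat_prod V X A q p) (\<lambda>p q. mat_prod V Y A q p) i j"
      by (rule cong) (use XD YD that in auto)
    also have "\<dots> = mat_prod V (mat_prod V Y A) (mat_prod V X A) j i"
      by (rule transp[symmetric])
    also have "\<dots> = mat_prod V Y (mat_prod V A (mat_prod V X A)) j i"
      by (rule mat_prod_assoc)
    also have "\<dots> = mat_prod V Y (mat_prod V (mat_prod V A X) A) j i"
      by (rule cong) (simp_all add: mat_prod_assoc)
    also have "\<dots> = mat_prod V Y A j i"
      by (rule cong) (use XD that in auto)
    finally show ?thesis using YD that by auto
  qed
  have "X i j = Y i j" for i j
  proof (cases "(i, j) \<in> V \<times> V")
    case True
    then have ij: "i \<in> V" "j \<in> V" by auto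
    have "X i j = mat_prod V (mat_prod V X A) X i j" using XD ij by auto
    also have "\<dots> = mat_prod V (mat_prod V Y A) X i j"
      by (rule cong) (use XA_YA ij in auto)
    also have "\<dots> = mat_prod V Y (mat_prod V A X) i j" by (rule mat_prod_assoc)
    also have "\<dots> = mat_prod V Y (mat_prod V A Y) i j"
      by (rule cong) (use AX_AY ij in auto)
    also have "\<dots> = mat_prod V (mat_prod V Y A) Y i j" by (rule mat_prod_assoc[symmetric])
    also have "\<dots> = Y i j" using YD ij by auto
    finally show ?thesis .
  next
    case False
    then show ?thesis using XD YD by auto
  qed
  then show ?thesis by blast
qed

lemma moore_penrose_eqI: "is_moore_penrose V A X \<Longrightarrow> moore_penrose V A = X"
  unfolding moore_penrose_def by (rule the_equality) (auto intro: is_moore_penrose_unique)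

definition laplacian :: "('a, 'b) pre_digraph \<Rightarrow> 'a \<Rightarrow> 'a \<Rightarrow> real" where
  "laplacian G i j =
     (if i = j then real (out_degree G i) else if (i, j) \<in> arcs_ends G then - 1 else 0)"

definition unit_vec :: "'a \<Rightarrow> 'a \<Rightarrow> real" where
  "unit_vec a i = (if i = a then 1 else 0)"

definition resistance :: "('a, 'b) pre_digraph \<Rightarrow> 'a \<Rightarrow> 'a \<Rightarrow> real" where
  "resistance G a b =
     (\<Sum>i\<in>verts G. \<Sum>j\<in>verts G.
        (unit_vec a i - unit_vec b i) * moore_penrose (verts G) (laplacian G) i j *
        (unit_vec a j - unit_vec b j))"

lemma resistance_sym: "resistance G a b = resistance G b a"
  unfolding resistance_def by (intro sum.cong refl) (simp add: algebra_simps)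

text \<open>
  The sum over unordered pairs: each pair of distinct vertices occurs twice among the ordered
  pairs, with the same resistance (lemma \<open>resistance_sym\<close>).
\<close>
definition kirchhoff_index :: "('a, 'b) pre_digraph \<Rightarrow> real" where
  "kirchhoff_index G = (\<Sum>u\<in>verts G. \<Sum>w\<in>verts G - {u}. resistance G u w) / 2"

definition good_vertices :: "('a, 'b) pre_digraph \<Rightarrow> 'a set" where
  "good_vertices G =
     {v \<in> verts G. Digraph_Component.connected (pre_digraph.del_vert G v) \<and>
        kirchhoff_index G = kirchhoff_index (pre_digraph.del_vert G v)}"

end

theory Submission
  imports Defs "HOL-Library.Countable"
begin

text \<open>
  Glue gadgets at a common vertex, the hub.  A gadget is a clique through the hub whose other
  vertices (the middle vertices) are partitioned into blocks; each block is moreover joined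
  completely to an independent set of outer vertices.  If a block has \<open>s + 1\<close> middle and \<open>s\<close> outer
  vertices, deleting a middle vertex \<open>v\<close> lengthens the way from the outer vertices to the hub,
  whereas the clique keeps \<open>v\<close> close to everything.  Already with three blocks the total gain in
  resistance towards the hub exceeds the average resistance to the hub.

  By the Green function grounded at the hub, \<open>Kf = n * T - \<Sigma>\<close>, where \<open>T\<close> is the sum of the
  resistances to the hub and \<open>\<Sigma>\<close> a sum of contributions of the gadgets.  Hence the middle vertices
  are good iff \<open>T = \<alpha> * (n - 1) + \<kappa>\<close>, with rational constants \<open>\<alpha>\<close> and \<open>\<kappa>\<close> depending only on \<open>s\<close>.
  With \<open>k\<close> copies of the gadget, \<open>T\<close> falls short of this value by about \<open>k * \<zeta>\<close>, where \<open>\<zeta> > 0\<close>; a path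
  of length of order \<open>sqrt k\<close> at the hub makes up for it, and a bounded filler gadget corrects
  the remainder exactly.  The outer vertices are never good, and the proportion of all other
  vertices outside the \<open>k\<close> copies tends to 0.
\<close>

section \<open>Kirchhoff index from a Green function\<close>

text \<open>
  With \<open>P = I - J / n\<close>, the Moore--Penrose inverse is \<open>P g P\<close>, since \<open>L P = L\<close> and \<open>1\<^sup>T P = 0\<close>.
\<close>
lemma kirchhoff_index_green:
  fixes G :: "('a, 'b) pre_digraph" and g :: "'a \<Rightarrow> 'a \<Rightarrow> real"
  defines "V \<equiv> verts G" and "L \<equiv> laplacian G"
  assumes fin: "finite V" and h: "h \<in> V"
    and L_sym: "\<And>i j. i \<in> V \<Longrightarrow> j \<in> V \<Longrightarrow> L i j = L j i"
    and L_row: "\<And>i. i \<in> V \<Longrightarrow> (\<Sum>j\<in>V. L i j) = 0"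
    and g_sym: "\<And>i j. i \<in> V \<Longrightarrow> j \<in> V \<Longrightarrow> g i j = g j i"
    and green: "\<And>i j. i \<in> V \<Longrightarrow> j \<in> V \<Longrightarrow>
      (\<Sum>k\<in>V. L i k * g k j) = of_bool (i = j) - of_bool (i = h)"
  shows "kirchhoff_index G = real (card V) * (\<Sum>i\<in>V. g i i) - (\<Sum>i\<in>V. \<Sum>j\<in>V. g i j)"
proof -
  define n where "n = real (card V)"
  have n: "n > 0" using fin h by (auto simp: n_def card_gt_0_iff)
  \<comment> \<open>\<open>r\<close> consists of the column means of \<open>g\<close> and
    \<open>c\<close> is its overall mean, so \<open>X\<close> is \<open>g\<close> centred in both
    arguments.\<close>
  define r where "r j = (\<Sum>i\<in>V. g i j) / n" for j
  define c where "c = (\<Sum>j\<in>V. r j) / n"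
  define X where "X i j = (if i \<in> V \<and> j \<in> V then g i j - r i - r j + c else 0)" for i j
  define P where "P i j = (of_bool (i = j) - 1 / n :: real)" for i j :: 'a
  have X_sym: "X i j = X j i" for i j
    using g_sym by (auto simp: X_def)
  have P_sym: "P i j = P j i" for i j by (auto simp: P_def)
  \<comment> \<open>Average \<open>green\<close> over its second index.\<close>
  have Lr: "(\<Sum>k\<in>V. L i k * r k) = 1 / n - of_bool (i = h)" if i: "i \<in> V" for i
  proof -
    have "(\<Sum>k\<in>V. L i k * r k) = (\<Sum>k\<in>V. \<Sum>l\<in>V. L i k * g k l) / n"
      unfolding sum_divide_distrib r_def
      by (intro sum.cong refl) (simp add: sum_distrib_left sum_divide_distrib g_sym)
    also have "(\<Sum>k\<in>V. \<Sum>l\<in>V. L i k * g k l) = (\<Sum>l\<in>V. of_bool (i = l) - of_bool (i = h))"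
      by (subst sum.swap) (simp add: green i)
    also have "\<dots> = 1 - n * of_bool (i = h)"
      using fin i by (simp add: sum_subtractf n_def of_bool_def)
    finally show ?thesis using n by (simp add: field_simps)
  qed
  have LX: "mat_prod V L X i j = P i j" if ij: "i \<in> V" "j \<in> V" for i j
  proof -
    have "mat_prod V L X i j = (\<Sum>k\<in>V. L i k * g k j - L i k * r k - L i k * r j + L i k * c)"
      unfolding mat_prod_def by (intro sum.cong refl) (simp add: X_def ij algebra_simps)
    also have "\<dots> = (\<Sum>k\<in>V. L i k * g k j) - (\<Sum>k\<in>V. L i k * r k) - (\<Sum>k\<in>V. L i k) * r j
        + (\<Sum>k\<in>V. L i k) * c"
      by (simp add: sum.distrib sum_subtractf sum_distrib_right)
    also have "\<dots> = P i j" by (simp add: green Lr L_row ij P_def)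
    finally show ?thesis .
  qed
  have XL: "mat_prod V X L i j = P i j" if ij: "i \<in> V" "j \<in> V" for i j
  proof -
    have "mat_prod V X L i j = mat_prod V L X j i"
      unfolding mat_prod_def using ij by (intro sum.cong refl) (simp add: X_sym L_sym mult.commute)
    then show ?thesis using LX ij P_sym by simp
  qed
  have col: "(\<Sum>k\<in>V. X k j) = 0" if j: "j \<in> V" for j
  proof -
    have "(\<Sum>k\<in>V. X k j) = (\<Sum>k\<in>V. g k j - r k - r j + c)"
      by (intro sum.cong refl) (simp add: X_def j)
    also have "\<dots> = 0"
      using n by (simp add: sum.distrib sum_subtractf n_def[symmetric] c_def) (simp add: r_def)
    finally show ?thesis .
  qed
  have P_prod: "(\<Sum>k\<in>V. P i k * M k j) = M i j - (\<Sum>k\<in>V. M k j) / n" if "i \<in> V" for i j M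
    using that fin by (simp add: P_def left_diff_distrib sum_subtractf sum_divide_distrib)
  have "is_moore_penrose V L X"
    unfolding is_moore_penrose_def
  proof (intro conjI ballI allI impI)
    fix i j assume ij: "i \<in> V" "j \<in> V"
    have "mat_prod V (mat_prod V L X) L i j = (\<Sum>k\<in>V. P i k * L k j)"
      unfolding mat_prod_def[of V "mat_prod V L X"] by (intro sum.cong refl) (simp add: LX ij)
    also have "\<dots> = L i j"
      using L_row[OF ij(2)] L_sym ij by (simp add: P_prod cong: sum.cong)
    finally show "mat_prod V (mat_prod V L X) L i j = L i j" .
    have "mat_prod V (mat_prod V X L) X i j = (\<Sum>k\<in>V. P i k * X k j)"
      unfolding mat_prod_def[of V "mat_prod V X L"] by (intro sum.cong refl) (simp add: XL ij)
    then show "mat_prod V (mat_prod V X L) X i j = X i j"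
      by (simp add: P_prod ij col)
    show "mat_prod V L X i j = mat_prod V L X j i" "mat_prod V X L i j = mat_prod V X L j i"
      by (simp_all add: LX XL ij P_sym)
  qed (auto simp: X_def)
  then have MP: "moore_penrose V L = X" by (rule moore_penrose_eqI)
  have res: "resistance G a b = g a a + g b b - 2 * g a b" if ab: "a \<in> V" "b \<in> V" for a b
  proof -
    have pick: "(\<Sum>i\<in>V. (unit_vec a i - unit_vec b i) * f i) = f a - f b" for f
      using fin ab by (simp add: unit_vec_def left_diff_distrib sum_subtractf if_distribR
          if_distrib[of "\<lambda>x. x * _"] cong: if_cong)
    have "resistance G a b = (\<Sum>i\<in>V. (unit_vec a i - unit_vec b i) *
        (\<Sum>j\<in>V. (unit_vec a j - unit_vec b j) * X i j))"
      unfolding resistance_def V_def[symmetric] L_def[symmetric] MP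
      by (simp add: sum_distrib_left mult_ac)
    also have "\<dots> = X a a - X a b - (X b a - X b b)" by (simp only: pick)
    also have "\<dots> = g a a + g b b - 2 * g a b"
      using ab g_sym[of a b] by (simp add: X_def)
    finally show ?thesis .
  qed
  \<comment> \<open>The summand \<open>g u u + g w w - 2 * g u w\<close> vanishes for
    \<open>w = u\<close>, so the inner sum may run over all of \<open>V\<close>.\<close>
  have "(\<Sum>u\<in>V. \<Sum>w\<in>V - {u}. resistance G u w) = (\<Sum>u\<in>V. \<Sum>w\<in>V. g u u + g w w - 2 * g u w)"
  proof (rule sum.cong[OF refl])
    fix u assume u: "u \<in> V"
    have "(\<Sum>w\<in>V - {u}. resistance G u w) = (\<Sum>w\<in>V - {u}. g u u + g w w - 2 * g u w)"
      using u by (intro sum.cong refl) (simp add: res)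
    also have "\<dots> = (\<Sum>w\<in>V. g u u + g w w - 2 * g u w)"
      using fin u by (simp add: sum_diff1)
    finally show "(\<Sum>w\<in>V - {u}. resistance G u w) = (\<Sum>w\<in>V. g u u + g w w - 2 * g u w)" .
  qed
  also have "\<dots> = 2 * (n * (\<Sum>i\<in>V. g i i) - (\<Sum>i\<in>V. \<Sum>j\<in>V. g i j))"
    by (simp add: sum.distrib sum_subtractf sum_distrib_left[symmetric] n_def)
  finally show ?thesis
    unfolding kirchhoff_index_def V_def[symmetric] n_def[symmetric] by simp
qed

section \<open>Graphs induced on finite subsets of a countable type\<close>

text \<open>All graphs are given by one fixed relation and varying vertex sets, so that deleting a
  vertex becomes a set difference. The encoding by \<open>to_nat\<close> puts them into the single
  type of digraphs on \<open>nat\<close>.\<close>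

definition induced :: "('v::countable \<Rightarrow> 'v \<Rightarrow> bool) \<Rightarrow> 'v set \<Rightarrow> (nat, nat \<times> nat) pre_digraph" where
  "induced E S = \<lparr>verts = to_nat ` S,
     arcs = {(to_nat x, to_nat y) | x y. x \<in> S \<and> y \<in> S \<and> E x y}, tail = fst, head = snd\<rparr>"

lemma verts_induced [simp]: "verts (induced E S) = to_nat ` S"
  by (simp add: induced_def)

lemma del_vert_induced: "pre_digraph.del_vert (induced E S) (to_nat x) = induced E (S - {x})"
  by (auto simp: pre_digraph.del_vert_def induced_def)

lemma arcs_ends_induced:
  "arcs_ends (induced E S) = {(to_nat x, to_nat y) | x y. x \<in> S \<and> y \<in> S \<and> E x y}"
  by (simp add: arcs_ends_conv induced_def)

lemma graph_induced:
  assumes "finite S" "symp E" "irreflp E"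
  shows "Digraph.graph (induced E S)"
proof -
  have "finite (arcs (induced E S))"
    by (rule finite_subset[of _ "to_nat ` S \<times> to_nat ` S"]) (use assms in \<open>auto simp: induced_def\<close>)
  moreover have "sym (arcs_ends (induced E S))"
    using assms(2) unfolding arcs_ends_induced by (auto simp: sym_def dest: sympD)
  ultimately show ?thesis
    using assms by unfold_locales
      (auto simp: induced_def arc_to_ends_def symmetric_def dest: irreflpD)
qed

text \<open>Two paths to \<open>h\<close> combine into a path between their starting points, because
  reachability in the symmetric closure is symmetric and transitive.\<close>

lemma connected_induced:
  assumes h: "h \<in> S" and E: "symp E"
    and path: "\<And>x. x \<in> S \<Longrightarrow> (x, h) \<in> {(x, y). x \<in> S \<and> y \<in> S \<and> E x y}\<^sup>*"
  shows "Digraph_Component.connected (induced E S)"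
proof -
  define R where "R = rtrancl_on (to_nat ` S) ((arcs_ends (induced E S))\<^sup>s)"
  have arc: "(to_nat x, to_nat y) \<in> (arcs_ends (induced E S))\<^sup>s" if "x \<in> S" "y \<in> S" "E x y" for x y
    using that by (auto simp: arcs_ends_induced symcl_def)
  have to_h: "(to_nat x, to_nat h) \<in> R" if "x \<in> S" for x
    using path[OF that]
  proof (induction rule: converse_rtrancl_induct)
    case base
    then show ?case using h by (simp add: R_def)
  next
    case (step x y)
    then show ?case unfolding R_def
      using converse_rtrancl_on_into_rtrancl_on[OF arc] by blast
  qed
  moreover have "sym R"
    unfolding R_def by (rule rtrancl_on_sym) (auto simp: sym_def symcl_def)
  ultimately have "(to_nat x, to_nat y) \<in> R" if "x \<in> S" "y \<in> S" for x y
    using that unfolding R_def by (meson rtrancl_on_trans symD)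
  then show ?thesis
    using h by (auto simp: connected_conv R_def)
qed

text \<open>The Laplacian applied to a function sums its differences along the edges at a vertex.
  The Green condition can therefore be checked neighbourhood by neighbourhood, with no reference to
  matrices or to \<open>to_nat\<close>.\<close>

lemma kirchhoff_index_induced:
  fixes E :: "'v::countable \<Rightarrow> 'v \<Rightarrow> bool" and g :: "'v \<Rightarrow> 'v \<Rightarrow> real"
  assumes fin: "finite S" and h: "h \<in> S" and E: "symp E" "irreflp E"
    and g_sym: "\<And>x y. x \<in> S \<Longrightarrow> y \<in> S \<Longrightarrow> g x y = g y x"
    and green: "\<And>x y. x \<in> S \<Longrightarrow> y \<in> S \<Longrightarrow>
      (\<Sum>z | z \<in> S \<and> E x z. g x y - g z y) = of_bool (x = y) - of_bool (x = h)"
  shows "kirchhoff_index (induced E S) =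
    real (card S) * (\<Sum>x\<in>S. g x x) - (\<Sum>x\<in>S. \<Sum>y\<in>S. g x y)"
proof -
  let ?G = "induced E S"
  have inj: "inj_on to_nat S" by (simp add: inj_on_subset[OF inj_to_nat])
  define g' where "g' i j = g (from_nat i) (from_nat j)" for i j
  have deg: "out_degree ?G (to_nat x) = card {z \<in> S. E x z}" if "x \<in> S" for x
  proof -
    have "out_arcs ?G (to_nat x) = (\<lambda>z. (to_nat x, to_nat z)) ` {z \<in> S. E x z}"
      using that by (auto simp: out_arcs_def induced_def)
    then show ?thesis
      by (simp add: out_degree_def card_image inj_on_def)
  qed
  have L: "laplacian ?G (to_nat x) (to_nat y) =
      of_bool (x = y) * real (card {z \<in> S. E x z}) - of_bool (E x y)" if "x \<in> S" "y \<in> S" for x y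
    using that E(2) by (auto simp: laplacian_def deg arcs_ends_induced dest: irreflpD)
  have L_sum: "(\<Sum>k\<in>to_nat ` S. laplacian ?G (to_nat x) k * f k) =
      (\<Sum>z | z \<in> S \<and> E x z. f (to_nat x) - f (to_nat z))" if "x \<in> S" for x and f :: "nat \<Rightarrow> real"
  proof -
    have "(\<Sum>k\<in>to_nat ` S. laplacian ?G (to_nat x) k * f k) =
        (\<Sum>z\<in>S. (of_bool (x = z) * real (card {z \<in> S. E x z}) - of_bool (E x z)) * f (to_nat z))"
      using that by (subst sum.reindex[OF inj]) (intro sum.cong, auto simp: L)
    also have "\<dots> = real (card {z \<in> S. E x z}) * f (to_nat x) - (\<Sum>z\<in>S. of_bool (E x z) * f (to_nat z))"
      using that fin by (simp add: left_diff_distrib sum_subtractf mult.assoc)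
    also have "(\<Sum>z\<in>S. of_bool (E x z) * f (to_nat z)) = (\<Sum>z | z \<in> S \<and> E x z. f (to_nat z))"
      using fin by (simp add: sum.inter_filter of_bool_def if_distrib[of "\<lambda>x. x * _"] cong: if_cong)
    finally show ?thesis by (simp add: sum_subtractf)
  qed
  have "kirchhoff_index ?G = real (card (verts ?G)) * (\<Sum>i\<in>verts ?G. g' i i)
      - (\<Sum>i\<in>verts ?G. \<Sum>j\<in>verts ?G. g' i j)"
  proof (rule kirchhoff_index_green[where h = "to_nat h"])
    fix i j assume "i \<in> verts ?G" "j \<in> verts ?G"
    then obtain x y where xy: "i = to_nat x" "j = to_nat y" "x \<in> S" "y \<in> S" by auto
    show "laplacian ?G i j = laplacian ?G j i"
      using xy E(1) by (auto simp: L dest: sympD)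
    show "g' i j = g' j i" using xy g_sym by (simp add: g'_def)
    have "(\<Sum>k\<in>verts ?G. laplacian ?G i k * g' k j) = (\<Sum>z | z \<in> S \<and> E x z. g x y - g z y)"
      unfolding verts_induced xy by (subst L_sum[OF xy(3)]) (simp add: g'_def)
    then show "(\<Sum>k\<in>verts ?G. laplacian ?G i k * g' k j) = of_bool (i = j) - of_bool (i = to_nat h)"
      using green[OF xy(3,4)] xy by simp
  next
    fix i assume "i \<in> verts ?G"
    then show "(\<Sum>j\<in>verts ?G. laplacian ?G i j) = 0"
      using L_sum[of _ "\<lambda>_. 1"] by auto
  qed (use fin h in auto)
  then show ?thesis
    by (simp add: sum.reindex[OF inj] card_image[OF inj] g'_def)
qed

section \<open>Gadgets glued at a hub\<close>

text \<open>The indices of \<open>Mid\<close> and \<open>Out\<close> name the gadget, the block in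
  the gadget and the vertex in the block. \<open>Tail i\<close> is the path vertex at distance
  \<open>i + 1\<close> from the hub.\<close>

datatype vertex = Hub | Mid nat nat nat | Out nat nat nat | Tail nat

instance vertex :: countable
  by countable_datatype

fun adj :: "vertex \<Rightarrow> vertex \<Rightarrow> bool" where
  "adj Hub (Mid c j i) \<longleftrightarrow> True"
| "adj (Mid c j i) Hub \<longleftrightarrow> True"
| "adj Hub (Tail i) \<longleftrightarrow> i = 0"
| "adj (Tail i) Hub \<longleftrightarrow> i = 0"
| "adj (Mid c j i) (Mid c' j' i') \<longleftrightarrow> c = c' \<and> (j, i) \<noteq> (j', i')"
| "adj (Mid c j i) (Out c' j' i') \<longleftrightarrow> c = c' \<and> j = j'"
| "adj (Out c j i) (Mid c' j' i') \<longleftrightarrow> c = c' \<and> j = j'"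
| "adj (Tail i) (Tail i') \<longleftrightarrow> i' = Suc i \<or> i = Suc i'"
| "adj _ _ \<longleftrightarrow> False"

lemma adj_sym: "adj x y \<Longrightarrow> adj y x"
  by (induction x y rule: adj.induct) auto

lemma symp_adj: "symp adj"
  by (rule sympI) (rule adj_sym)

lemma irreflp_adj: "irreflp adj"
proof (rule irreflpI)
  show "\<not> adj x x" for x by (cases x) auto
qed

text \<open>Outer vertices count as well: this is membership in gadget \<open>c\<close> without the
  hub.\<close>

fun in_clique :: "nat \<Rightarrow> vertex \<Rightarrow> bool" where
  "in_clique c (Mid c' j i) \<longleftrightarrow> c = c'"
| "in_clique c (Out c' j i) \<longleftrightarrow> c = c'"
| "in_clique c _ \<longleftrightarrow> False"

fun in_block :: "nat \<Rightarrow> nat \<Rightarrow> vertex \<Rightarrow> bool" where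
  "in_block c j (Mid c' j' i) \<longleftrightarrow> c = c' \<and> j = j'"
| "in_block c j (Out c' j' i) \<longleftrightarrow> c = c' \<and> j = j'"
| "in_block c j _ \<longleftrightarrow> False"

fun is_out :: "nat \<Rightarrow> nat \<Rightarrow> vertex \<Rightarrow> bool" where
  "is_out c j (Out c' j' i) \<longleftrightarrow> c = c' \<and> j = j'"
| "is_out c j _ \<longleftrightarrow> False"

text \<open>The \<open>1\<close> is the hub. It is left out of \<open>gadget_order\<close>, because
  all gadgets share it.\<close>

definition clique_order :: "nat \<Rightarrow> (nat \<Rightarrow> nat) \<Rightarrow> real" where
  "clique_order J t = 1 + (\<Sum>j<J. real (t j))"

definition gadget_order :: "nat \<Rightarrow> (nat \<Rightarrow> nat) \<Rightarrow> (nat \<Rightarrow> nat) \<Rightarrow> real" where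
  "gadget_order J t b = (\<Sum>j<J. real (t j) + real (b j))"

text \<open>
  \<open>gadget_trace\<close> and \<open>gadget_sum\<close> are the contributions of a gadget with \<open>J\<close> blocks to the trace and
  to the sum of all entries of the Green function grounded at the hub; they are meaningful only
  if \<open>t j > 0\<close> for all \<open>j < J\<close>.
\<close>
definition gadget_trace :: "nat \<Rightarrow> (nat \<Rightarrow> nat) \<Rightarrow> (nat \<Rightarrow> nat) \<Rightarrow> real" where
  "gadget_trace J t b = (let m = clique_order J t in
     gadget_order J t b / m + (\<Sum>j<J. (real (t j) - 1) / (m + real (b j))
       + (real (t j) + real (b j)) / (real (t j) * m) + real (b j) / real (t j)))"

definition gadget_sum :: "nat \<Rightarrow> (nat \<Rightarrow> nat) \<Rightarrow> (nat \<Rightarrow> nat) \<Rightarrow> real" where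
  "gadget_sum J t b = (let m = clique_order J t in
     (gadget_order J t b)\<^sup>2 / m + (\<Sum>j<J. (real (t j) + real (b j))\<^sup>2 / (real (t j) * m)
       + real (b j) / real (t j)))"

text \<open>Only the sizes of the blocks are prescribed, not the indices that occur in them. Hence
  the graph left after deleting a vertex is again an instance, with one size lowered.\<close>

locale gadget_graph =
  fixes S :: "vertex set" and C :: nat and J :: "nat \<Rightarrow> nat"
    and t b :: "nat \<Rightarrow> nat \<Rightarrow> nat" and l :: nat
  assumes finite_S [simp]: "finite S"
    and Hub_in [simp]: "Hub \<in> S"
    and Mid_bound: "Mid c j i \<in> S \<Longrightarrow> c < C \<and> j < J c"
    and Out_bound: "Out c j i \<in> S \<Longrightarrow> c < C \<and> j < J c"
    and card_Mid: "c < C \<Longrightarrow> j < J c \<Longrightarrow> card {i. Mid c j i \<in> S} = t c j"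
    and card_Out: "c < C \<Longrightarrow> j < J c \<Longrightarrow> card {i. Out c j i \<in> S} = b c j"
    and t_pos: "c < C \<Longrightarrow> j < J c \<Longrightarrow> t c j > 0"
    and Tail_iff: "Tail i \<in> S \<longleftrightarrow> i < l"
begin

definition mids :: "nat \<Rightarrow> nat \<Rightarrow> vertex set" where
  "mids c j = Mid c j ` {i. Mid c j i \<in> S}"

definition outs :: "nat \<Rightarrow> nat \<Rightarrow> vertex set" where
  "outs c j = Out c j ` {i. Out c j i \<in> S}"

abbreviation m :: "nat \<Rightarrow> real" where "m c \<equiv> clique_order (J c) (t c)"

text \<open>
  Adding the all-ones matrix to the Laplacian of a clique of order \<open>m\<close> gives \<open>m\<close> times the identity:
  relative to the mean potential of the clique, every vertex is tied to the ground
  by a conductance \<open>m\<close>.  This decouples the blocks; grounding the hub instead adds \<open>1 / m\<close> everywhere.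
\<close>
fun g :: "vertex \<Rightarrow> vertex \<Rightarrow> real" where
  "g (Mid c j i) (Mid c' j' i') = of_bool (c = c') / m c + of_bool (c = c' \<and> j = j') *
     ((of_bool (i = i') - 1 / real (t c j)) / (m c + real (b c j)) + 1 / (real (t c j) * m c))"
| "g (Mid c j i) (Out c' j' i') = of_bool (c = c') / m c + of_bool (c = c' \<and> j = j') / (real (t c j) * m c)"
| "g (Out c j i) (Mid c' j' i') = of_bool (c = c') / m c + of_bool (c = c' \<and> j = j') / (real (t c j) * m c)"
| "g (Out c j i) (Out c' j' i') = of_bool (c = c') / m c + of_bool (c = c' \<and> j = j') *
     (1 / (real (t c j) * m c) + of_bool (i = i') / real (t c j))"
| "g (Tail i) (Tail i') = real (min i i') + 1"
| "g _ _ = 0"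

lemma g_sym: "g x y = g y x"
  by (induction x y rule: g.induct) (auto simp: min.commute)

lemma m_pos: "m c > 0"
  unfolding clique_order_def by (intro add_pos_nonneg sum_nonneg) auto

lemma finite_preimage: "finite {i. Mid c j i \<in> S}" "finite {i. Out c j i \<in> S}"
  by (rule finite_vimageI[of S, unfolded vimage_def]; simp add: inj_on_def)+

lemma finite_blocks [simp]: "finite (mids c j)" "finite (outs c j)"
  by (simp_all add: mids_def outs_def finite_preimage)

lemma sum_mids: "(\<Sum>z\<in>mids c j. f z) = (\<Sum>i | Mid c j i \<in> S. f (Mid c j i))"
  unfolding mids_def by (subst sum.reindex) (auto simp: inj_on_def)

lemma sum_outs: "(\<Sum>z\<in>outs c j. f z) = (\<Sum>i | Out c j i \<in> S. f (Out c j i))"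
  unfolding outs_def by (subst sum.reindex) (auto simp: inj_on_def)

lemma card_blocks: "c < C \<Longrightarrow> j < J c \<Longrightarrow> card (mids c j) = t c j"
  "c < C \<Longrightarrow> j < J c \<Longrightarrow> card (outs c j) = b c j"
  by (simp_all add: mids_def outs_def card_image inj_on_def card_Mid card_Out)

lemma sum_S:
  fixes f :: "vertex \<Rightarrow> real"
  shows "(\<Sum>z\<in>S. f z) =
    f Hub + (\<Sum>c<C. \<Sum>j<J c. (\<Sum>z\<in>mids c j. f z) + (\<Sum>z\<in>outs c j. f z)) + (\<Sum>i<l. f (Tail i))"
proof -
  define B where "B c j = mids c j \<union> outs c j" for c j
  have S: "S = insert Hub ((\<Union>c\<in>{..<C}. \<Union>j\<in>{..<J c}. B c j) \<union> Tail ` {..<l})" (is "_ = insert _ (?U \<union> ?T)")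
  proof (rule set_eqI)
    fix x show "x \<in> S \<longleftrightarrow> x \<in> insert Hub (?U \<union> ?T)"
      by (cases x) (auto simp: B_def mids_def outs_def Tail_iff dest: Mid_bound Out_bound)
  qed
  have disj: "Hub \<notin> ?U \<union> ?T" "?U \<inter> ?T = {}"
    by (auto simp: B_def mids_def outs_def)
  have "(\<Sum>z\<in>?U. f z) = (\<Sum>c<C. \<Sum>z\<in>(\<Union>j\<in>{..<J c}. B c j). f z)"
    by (rule sum.UNION_disjoint) (auto simp: B_def mids_def outs_def finite_preimage)
  also have "\<dots> = (\<Sum>c<C. \<Sum>j<J c. \<Sum>z\<in>B c j. f z)"
    by (intro sum.cong refl sum.UNION_disjoint) (auto simp: B_def mids_def outs_def finite_preimage)
  also have "\<dots> = (\<Sum>c<C. \<Sum>j<J c. (\<Sum>z\<in>mids c j. f z) + (\<Sum>z\<in>outs c j. f z))"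
    unfolding B_def by (intro sum.cong refl sum.union_disjoint) (auto, auto simp: mids_def outs_def)
  finally have U: "(\<Sum>z\<in>?U. f z) = \<dots>" .
  have T: "(\<Sum>z\<in>?T. f z) = (\<Sum>i<l. f (Tail i))"
    by (subst sum.reindex) (auto simp: inj_on_def)
  have fin: "finite ?U" "finite ?T" by (auto simp: B_def)
  have "(\<Sum>z\<in>S. f z) = f Hub + (\<Sum>z\<in>?U \<union> ?T. f z)"
    by (subst S) (use disj fin in simp)
  also have "(\<Sum>z\<in>?U \<union> ?T. f z) = (\<Sum>z\<in>?U. f z) + (\<Sum>z\<in>?T. f z)"
    using disj fin by (intro sum.union_disjoint) auto
  finally show ?thesis by (simp add: U T)
qed

section \<open>Verification of the Green function\<close>

lemma sum_mids_g:
  assumes c: "c < C" "j < J c" and y: "y \<in> S"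
  shows "(\<Sum>z\<in>mids c j. g z y) = of_bool (in_clique c y) * real (t c j) / m c + of_bool (in_block c j y) / m c"
proof -
  have t: "real (t c j) > 0" using t_pos[OF c] by simp
  note [simp] = card_Mid[OF c] finite_preimage
  show ?thesis
  proof (cases y)
    case (Mid c' j' i')
    show ?thesis
    proof (cases "c = c' \<and> j = j'")
      case True
      then have [simp]: "c' = c" "j' = j" by simp_all
      then have i': "Mid c j i' \<in> S" using y Mid by simp
      \<comment> \<open>This part of \<open>g\<close> is the inverse on vectors of mean zero; summed
        over the \<open>t c j\<close> middle vertices of the block, it cancels.\<close>
      have "(\<Sum>i | Mid c j i \<in> S. (of_bool (i = i') - 1 / real (t c j)) / (m c + real (b c j))) = 0"
        unfolding sum_divide_distrib[symmetric] sum_subtractf using t i' by simp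
      then show ?thesis
        using Mid t by (simp add: sum_mids sum.distrib)
    qed (use Mid in \<open>auto simp: sum_mids\<close>)
  qed (use t in \<open>auto simp: sum_mids sum.distrib distrib_left\<close>)
qed

lemma sum_outs_g:
  assumes c: "c < C" "j < J c" and y: "y \<in> S"
  shows "(\<Sum>z\<in>outs c j. g z y) = of_bool (in_clique c y) * real (b c j) / m c
    + of_bool (in_block c j y) * real (b c j) / (real (t c j) * m c) + of_bool (is_out c j y) / real (t c j)"
proof -
  note [simp] = card_Out[OF c] finite_preimage
  show ?thesis
  proof (cases y)
    case (Out c' j' i')
    show ?thesis
    proof (cases "c = c' \<and> j = j'")
      case True
      then have [simp]: "c' = c" "j' = j" by simp_all
      then have i': "Out c j i' \<in> S" using y Out by simp
      have "(\<Sum>i | Out c j i \<in> S. of_bool (i = i') / real (t c j)) = 1 / real (t c j)"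
        unfolding sum_divide_distrib[symmetric] using i' by simp
      then show ?thesis
        using Out by (simp add: sum_outs sum.distrib)
    qed (use Out in \<open>auto simp: sum_outs\<close>)
  qed (auto simp: sum_outs sum.distrib distrib_left)
qed

text \<open>At most one block of gadget \<open>c\<close> contains \<open>y\<close>, and the bounds
  of the locale put its index below \<open>J c\<close>. The default \<open>0\<close> only occurs
  where the factor \<open>of_bool (in_clique c y)\<close> is zero.\<close>

lemma sum_in_block:
  assumes "c < C" "y \<in> S"
  shows "(\<Sum>j<J c. of_bool (in_block c j y) * f j) = (of_bool (in_clique c y) * f (case y of Mid _ j _ \<Rightarrow> j | Out _ j _ \<Rightarrow> j | _ \<Rightarrow> 0) :: real)"
  using assms by (cases y) (auto dest: Mid_bound Out_bound)

text \<open>With the hub at potential 0, this is the current that flows from gadget \<open>c\<close>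
  into the hub when a unit current enters at \<open>y\<close>: everything if \<open>y\<close> lies
  in the gadget, otherwise nothing.\<close>

lemma sum_clique_g:
  assumes c: "c < C" and y: "y \<in> S"
  shows "(\<Sum>j<J c. \<Sum>z\<in>mids c j. g z y) = of_bool (in_clique c y)"
proof -
  have "(\<Sum>j<J c. \<Sum>z\<in>mids c j. g z y) =
      (\<Sum>j<J c. of_bool (in_clique c y) * real (t c j) / m c) + (\<Sum>j<J c. of_bool (in_block c j y) * (1 / m c))"
    using c y by (simp add: sum_mids_g sum.distrib)
  also have "\<dots> = of_bool (in_clique c y) * ((\<Sum>j<J c. real (t c j)) / m c + 1 / m c)"
    unfolding sum_in_block[OF c y] by (simp add: sum_divide_distrib)
  also have "(\<Sum>j<J c. real (t c j)) / m c + 1 / m c = 1"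
    using m_pos[of c] by (simp add: add_divide_distrib[symmetric] clique_order_def add.commute)
  finally show ?thesis by simp
qed


lemma green:
  assumes x: "x \<in> S" and y: "y \<in> S"
  shows "(\<Sum>z | z \<in> S \<and> adj x z. g x y - g z y) = of_bool (x = y) - of_bool (x = Hub)"
proof (cases x)
  case Hub
  \<comment> \<open>Since \<open>g Hub y = 0\<close>, the equation at the hub only involves the sum
    of \<open>g\<close> over the neighbours.\<close>
  have "(\<Sum>z | z \<in> S \<and> adj Hub z. g z y) = (\<Sum>z\<in>S. if adj Hub z then g z y else 0)"
    by (simp add: sum.inter_filter)
  also have "\<dots> = (\<Sum>c<C. \<Sum>j<J c. \<Sum>z\<in>mids c j. g z y) + (\<Sum>i<l. if i = 0 then g (Tail i) y else 0)"
    unfolding sum_S by (simp add: sum_mids sum_outs cong: if_cong)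
  also have "(\<Sum>c<C. \<Sum>j<J c. \<Sum>z\<in>mids c j. g z y) = (\<Sum>c<C. of_bool (in_clique c y))"
    using y by (intro sum.cong refl) (simp add: sum_clique_g)
  also have "\<dots> + (\<Sum>i<l. if i = 0 then g (Tail i) y else 0) = of_bool (y \<noteq> Hub)"
  proof (cases y)
    case (Tail i)
    then have "l > 0" using y by (simp add: Tail_iff)
    then show ?thesis using Tail by simp
  qed (use y in \<open>auto dest: Mid_bound Out_bound\<close>)
  finally show ?thesis
    using Hub by (cases y) (simp_all add: sum_negf)
next
  case (Mid c j i)
  then have c: "c < C" "j < J c" using x Mid_bound by auto
  let ?M = "\<Union>j\<in>{..<J c}. mids c j"
  have nb: "{z. z \<in> S \<and> adj x z} = insert Hub ((?M - {x}) \<union> outs c j)"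
  proof (rule set_eqI)
    fix z show "z \<in> {z. z \<in> S \<and> adj x z} \<longleftrightarrow> z \<in> insert Hub ((?M - {x}) \<union> outs c j)"
      using Mid by (cases z) (auto simp: mids_def outs_def dest: Mid_bound)
  qed
  have xM: "x \<in> ?M" using Mid x c by (auto simp: mids_def)
  have sum_M: "(\<Sum>z\<in>?M. f z) = (\<Sum>j<J c. \<Sum>z\<in>mids c j. f z)" for f :: "vertex \<Rightarrow> real"
    by (rule sum.UNION_disjoint) (auto, auto simp: mids_def)
  have "(\<Sum>z | z \<in> S \<and> adj x z. g x y - g z y) =
      g x y + (\<Sum>z\<in>?M. g x y - g z y) + (\<Sum>z\<in>outs c j. g x y - g z y)"
  proof -
    have "(\<Sum>z | z \<in> S \<and> adj x z. g x y - g z y) =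
        g x y + (\<Sum>z\<in>(?M - {x}) \<union> outs c j. g x y - g z y)"
      unfolding nb by (subst sum.insert) (auto, auto simp: mids_def outs_def)
    also have "(\<Sum>z\<in>(?M - {x}) \<union> outs c j. g x y - g z y) =
        (\<Sum>z\<in>?M - {x}. g x y - g z y) + (\<Sum>z\<in>outs c j. g x y - g z y)"
      by (rule sum.union_disjoint) (auto, auto simp: mids_def outs_def)
    \<comment> \<open>The difference at \<open>z = x\<close> is zero, so the sum may be completed to
      all \<open>m c - 1\<close> middle vertices of the gadget.\<close>
    also have "(\<Sum>z\<in>?M - {x}. g x y - g z y) = (\<Sum>z\<in>?M. g x y - g z y)"
      using xM by (subst sum_diff1) auto
    finally show ?thesis by simp
  qed
  also have "(\<Sum>z\<in>?M. g x y - g z y) = (m c - 1) * g x y - of_bool (in_clique c y)"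
  proof -
    have "(\<Sum>z\<in>?M. g x y - g z y) =
        (\<Sum>j<J c. real (t c j) * g x y) - (\<Sum>j<J c. \<Sum>z\<in>mids c j. g z y)"
      unfolding sum_M sum_subtractf[symmetric]
      by (intro sum.cong refl) (simp add: sum_subtractf card_blocks c)
    then show ?thesis
      using c y by (simp add: sum_clique_g clique_order_def sum_distrib_right)
  qed
  also have "(\<Sum>z\<in>outs c j. g x y - g z y) = real (b c j) * g x y - (\<Sum>z\<in>outs c j. g z y)"
    using c by (simp add: sum_subtractf card_blocks)
  finally have *: "(\<Sum>z | z \<in> S \<and> adj x z. g x y - g z y) =
      (m c + real (b c j)) * g x y - of_bool (in_clique c y) - (\<Sum>z\<in>outs c j. g z y)"
    by (simp add: algebra_simps)
  have pos: "m c > 0" "m c + real (b c j) > 0" "real (t c j) > 0"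
    using m_pos[of c] t_pos[OF c] by auto
  \<comment> \<open>This is the case where \<open>y\<close> is a middle vertex of the same block as
    \<open>x\<close>, the only one in which the right-hand side can be nonzero.\<close>
  have mid: "(m c + real (b c j)) * g (Mid c j i) (Mid c j i') - 1 - real (b c j) / m c
      - real (b c j) / (real (t c j) * m c) = of_bool (i = i')" for i'
  proof -
    have "(m c + real (b c j)) * ((of_bool (i = i') - 1 / real (t c j)) / (m c + real (b c j))) =
        of_bool (i = i') - 1 / real (t c j)" using pos by simp
    then have "(m c + real (b c j)) * g (Mid c j i) (Mid c j i') = of_bool (i = i') - 1 / real (t c j)
        + (m c + real (b c j)) * (1 / m c + 1 / (real (t c j) * m c))"
      by (simp add: algebra_simps)
    also have "(m c + real (b c j)) * (1 / m c + 1 / (real (t c j) * m c)) =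
        1 + 1 / real (t c j) + real (b c j) / m c + real (b c j) / (real (t c j) * m c)"
      using pos(1,3) by (simp add: field_simps)
    finally show ?thesis by simp
  qed
  show ?thesis
  proof (cases y)
    case (Mid c' j' i')
    show ?thesis
    proof (cases "c' = c \<and> j' = j")
      case True
      then have "y = Mid c j i'" using Mid by simp
      moreover have "(\<Sum>z\<in>outs c j. g z (Mid c j i')) = real (b c j) / m c + real (b c j) / (real (t c j) * m c)"
        using sum_outs_g[OF c y] Mid True by simp
      ultimately show ?thesis
        unfolding * using mid[of i'] \<open>x = Mid c j i\<close> by (simp del: g.simps)
    next
      case False
      then show ?thesis
        unfolding * sum_outs_g[OF c y] using Mid \<open>x = Mid c j i\<close> pos
        by (auto simp: add_divide_distrib)
    qed
  next
    case (Out c' j' i')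
    then show ?thesis
      unfolding * sum_outs_g[OF c y] using \<open>x = Mid c j i\<close> pos
      by (auto simp: add_divide_distrib distrib_left)
  qed (unfold * sum_outs_g[OF c y], use \<open>x = Mid c j i\<close> in auto)
next
  case (Out c j i)
  then have c: "c < C" "j < J c" using x Out_bound by auto
  have nb: "{z. z \<in> S \<and> adj x z} = mids c j"
  proof (rule set_eqI)
    fix z show "z \<in> {z. z \<in> S \<and> adj x z} \<longleftrightarrow> z \<in> mids c j"
      using Out by (cases z) (auto simp: mids_def)
  qed
  have pos: "m c > 0" "real (t c j) > 0"
    using m_pos[of c] t_pos[OF c] by auto
  have "(\<Sum>z | z \<in> S \<and> adj x z. g x y - g z y) = real (t c j) * g x y - (\<Sum>z\<in>mids c j. g z y)"
    unfolding nb using c by (simp add: sum_subtractf card_blocks)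
  then show ?thesis
    unfolding sum_mids_g[OF c y] using Out pos by (cases y) (auto simp: distrib_left)
next
  case (Tail i)
  show ?thesis
  \<comment> \<open>The first path vertex has the hub in place of a predecessor, and the last one
    has no successor.\<close>
  proof (cases i)
    case 0
    have nb: "{z. z \<in> S \<and> adj x z} = insert Hub (if 1 < l then {vertex.Tail 1} else {})"
    proof (rule set_eqI)
      fix z show "z \<in> {z. z \<in> S \<and> adj x z} \<longleftrightarrow> z \<in> insert Hub (if 1 < l then {vertex.Tail 1} else {})"
        using Tail 0 by (cases z) (auto simp: Tail_iff)
    qed
    show ?thesis
      unfolding nb using Tail 0 x y by (cases y) (auto simp: Tail_iff)
  next
    case (Suc k)
    have nb: "{z. z \<in> S \<and> adj x z} = insert (vertex.Tail k) (if Suc i < l then {vertex.Tail (Suc i)} else {})"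
    proof (rule set_eqI)
      fix z show "z \<in> {z. z \<in> S \<and> adj x z} \<longleftrightarrow> z \<in> insert (vertex.Tail k) (if Suc i < l then {vertex.Tail (Suc i)} else {})"
        using Tail Suc x by (cases z) (auto simp: Tail_iff)
    qed
    show ?thesis
      unfolding nb using Tail Suc x y by (cases y) (auto simp: Tail_iff min_def)
  qed
qed

section \<open>Row sums, total sum and trace of the Green function\<close>

lemma sum_g:
  assumes y: "y \<in> S"
  shows "(\<Sum>z\<in>S. g y z) = (\<Sum>c<C. of_bool (in_clique c y) * (gadget_order (J c) (t c) (b c) / m c)
      + (\<Sum>j<J c. of_bool (in_block c j y) * ((real (t c j) + real (b c j)) / (real (t c j) * m c)))
      + (\<Sum>j<J c. of_bool (is_out c j y) / real (t c j)))
    + (\<Sum>i<l. g y (Tail i))"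
proof -
  have Hub: "g y Hub = 0" by (cases y) auto
  have "(\<Sum>j<J c. (\<Sum>z\<in>mids c j. g y z) + (\<Sum>z\<in>outs c j. g y z)) =
      of_bool (in_clique c y) * (gadget_order (J c) (t c) (b c) / m c)
      + (\<Sum>j<J c. of_bool (in_block c j y) * ((real (t c j) + real (b c j)) / (real (t c j) * m c)))
      + (\<Sum>j<J c. of_bool (is_out c j y) / real (t c j))" if c: "c < C" for c
  proof -
    have "(\<Sum>j<J c. (\<Sum>z\<in>mids c j. g y z) + (\<Sum>z\<in>outs c j. g y z)) =
        (\<Sum>j<J c. of_bool (in_clique c y) * ((real (t c j) + real (b c j)) / m c)
          + of_bool (in_block c j y) * ((real (t c j) + real (b c j)) / (real (t c j) * m c))
          + of_bool (is_out c j y) / real (t c j))"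
    proof (intro sum.cong refl)
      fix j assume "j \<in> {..<J c}"
      then have j: "j < J c" by simp
      show "(\<Sum>z\<in>mids c j. g y z) + (\<Sum>z\<in>outs c j. g y z) =
        of_bool (in_clique c y) * ((real (t c j) + real (b c j)) / m c)
          + of_bool (in_block c j y) * ((real (t c j) + real (b c j)) / (real (t c j) * m c))
          + of_bool (is_out c j y) / real (t c j)"
        using t_pos[OF c j] unfolding g_sym[of y] by (simp add: sum_mids_g sum_outs_g c j y add_divide_distrib)
    qed
    moreover have "gadget_order (J c) (t c) (b c) / m c = (\<Sum>j<J c. (real (t c j) + real (b c j)) / m c)"
      unfolding gadget_order_def sum_divide_distrib ..
    ultimately show ?thesis
      by (simp add: sum.distrib sum_distrib_left)
  qed
  then show ?thesis
    by (simp add: sum_S[of "g y"] Hub)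
qed

lemma sum_g_block:
  assumes c: "c < C" "j < J c" and y: "y \<in> S" "in_block c j y"
  shows "(\<Sum>z\<in>S. g y z) = gadget_order (J c) (t c) (b c) / m c
    + (real (t c j) + real (b c j)) / (real (t c j) * m c) + of_bool (is_out c j y) / real (t c j)"
proof -
  have bools: "in_clique c' y \<longleftrightarrow> c' = c" "in_block c' j' y \<longleftrightarrow> c' = c \<and> j' = j"
    "is_out c' j' y \<longleftrightarrow> (c' = c \<and> j' = j) \<and> is_out c j y" for c' j'
    using y(2) by (cases y; auto)+
  have inner: "(\<Sum>j'<J c'. of_bool (c' = c \<and> j' = j) * f j') = (if c' = c then f j else 0)"
    for c' and f :: "nat \<Rightarrow> real"
    using c by (cases "c' = c") simp_all
  have tail: "g y (Tail i) = 0" for i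
    using y(2) by (cases y) auto
  have "(\<Sum>z\<in>S. g y z) = (\<Sum>c'<C. if c' = c then gadget_order (J c) (t c) (b c) / m c
    + (real (t c j) + real (b c j)) / (real (t c j) * m c) + of_bool (is_out c j y) / real (t c j) else 0)"
    unfolding sum_g[OF y(1)] tail sum.neutral_const add_0_right
  proof (intro sum.cong refl)
    fix c'
    have out: "of_bool (is_out c' j' y) / real (t c' j') =
        of_bool (c' = c \<and> j' = j) * (of_bool (is_out c j y) / real (t c' j'))" for j'
      by (subst bools(3)[of c' j']) simp
    show "of_bool (in_clique c' y) * (gadget_order (J c') (t c') (b c') / m c') +
        (\<Sum>j'<J c'. of_bool (in_block c' j' y) * ((real (t c' j') + real (b c' j')) / (real (t c' j') * m c'))) +
        (\<Sum>j'<J c'. of_bool (is_out c' j' y) / real (t c' j')) =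
      (if c' = c then gadget_order (J c) (t c) (b c) / m c
        + (real (t c j) + real (b c j)) / (real (t c j) * m c) + of_bool (is_out c j y) / real (t c j) else 0)"
      unfolding out bools(1,2) inner by simp
  qed
  then show ?thesis using c by simp
qed

text \<open>The row sums are constant on the middle vertices and on the outer vertices of a block,
  the latter being larger by \<open>1 / t\<close>; weighting them by the sizes gives
  \<open>gadget_sum\<close>.\<close>

lemma sum_sum_g:
  "(\<Sum>y\<in>S. \<Sum>z\<in>S. g y z) = (\<Sum>c<C. gadget_sum (J c) (t c) (b c))
    + (\<Sum>i<l. \<Sum>i'<l. real (min i i') + 1)"
proof -
  let ?N = "\<lambda>c. gadget_order (J c) (t c) (b c)"
  have row_mid: "(\<Sum>z\<in>S. g (Mid c j i) z) = ?N c / m c + (real (t c j) + real (b c j)) / (real (t c j) * m c)"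
    if "Mid c j i \<in> S" for c j i
  proof -
    have c: "c < C" "j < J c" using that Mid_bound by auto
    show ?thesis using sum_g_block[OF c that] by simp
  qed
  have row_out: "(\<Sum>z\<in>S. g (Out c j i) z) = ?N c / m c + (real (t c j) + real (b c j)) / (real (t c j) * m c)
      + 1 / real (t c j)" if "Out c j i \<in> S" for c j i
  proof -
    have c: "c < C" "j < J c" using that Out_bound by auto
    show ?thesis using sum_g_block[OF c that] by simp
  qed
  have row_tail: "(\<Sum>z\<in>S. g (Tail i) z) = (\<Sum>i'<l. real (min i i') + 1)" if "i < l" for i
    using that by (subst sum_g) (simp_all add: Tail_iff)
  have row_hub: "(\<Sum>z\<in>S. g Hub z) = 0" by (subst sum_g) simp_all
  have "(\<Sum>j<J c. (\<Sum>y\<in>mids c j. \<Sum>z\<in>S. g y z) + (\<Sum>y\<in>outs c j. \<Sum>z\<in>S. g y z)) =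
      gadget_sum (J c) (t c) (b c)" if c: "c < C" for c
  proof -
    have "(\<Sum>j<J c. (\<Sum>y\<in>mids c j. \<Sum>z\<in>S. g y z) + (\<Sum>y\<in>outs c j. \<Sum>z\<in>S. g y z)) =
      (\<Sum>j<J c. (real (t c j) + real (b c j)) * (?N c / m c)
        + ((real (t c j) + real (b c j))\<^sup>2 / (real (t c j) * m c) + real (b c j) / real (t c j)))"
    proof (intro sum.cong refl)
      fix j assume "j \<in> {..<J c}"
      then have j: "j < J c" by simp
      show "(\<Sum>y\<in>mids c j. \<Sum>z\<in>S. g y z) + (\<Sum>y\<in>outs c j. \<Sum>z\<in>S. g y z) =
        (real (t c j) + real (b c j)) * (?N c / m c)
        + ((real (t c j) + real (b c j))\<^sup>2 / (real (t c j) * m c) + real (b c j) / real (t c j))"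
      proof -
        have "t * (u + v) + b * (u + v + 1 / w) = (t + b) * u + ((t + b) * v + b / w)"
          for t b u v w :: real by (simp add: algebra_simps)
        then show ?thesis
          unfolding sum_mids sum_outs
          by (simp add: row_mid row_out card_Mid card_Out c j power2_eq_square)
      qed
    qed
    also have "\<dots> = gadget_sum (J c) (t c) (b c)"
      unfolding gadget_sum_def Let_def sum.distrib[of "\<lambda>j. (real (t c j) + real (b c j)) * (?N c / m c)"]
        sum_distrib_right[symmetric] gadget_order_def[symmetric]
      by (simp add: power2_eq_square)
    finally show ?thesis .
  qed
  then show ?thesis
    unfolding sum_S[of "\<lambda>y. \<Sum>z\<in>S. g y z"] by (simp add: row_hub row_tail)
qed

lemma trace_g:
  "(\<Sum>y\<in>S. g y y) = (\<Sum>c<C. gadget_trace (J c) (t c) (b c)) + (\<Sum>i<l. real i + 1)"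
proof -
  have "(\<Sum>j<J c. (\<Sum>y\<in>mids c j. g y y) + (\<Sum>y\<in>outs c j. g y y)) =
      gadget_trace (J c) (t c) (b c)" if c: "c < C" for c
  proof -
    have "(\<Sum>j<J c. (\<Sum>y\<in>mids c j. g y y) + (\<Sum>y\<in>outs c j. g y y)) =
      (\<Sum>j<J c. (real (t c j) + real (b c j)) / m c + ((real (t c j) - 1) / (m c + real (b c j))
       + (real (t c j) + real (b c j)) / (real (t c j) * m c) + real (b c j) / real (t c j)))"
    proof (intro sum.cong refl)
      fix j assume "j \<in> {..<J c}"
      then have j: "j < J c" by simp
      have pos: "real (t c j) > 0" "m c > 0" "m c + real (b c j) > 0"
        using t_pos[OF c j] m_pos[of c] by auto
      have "(\<Sum>y\<in>mids c j. g y y) = real (t c j) * (1 / m c +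
          ((1 - 1 / real (t c j)) / (m c + real (b c j)) + 1 / (real (t c j) * m c)))"
        unfolding sum_mids by (simp add: card_Mid c j)
      also have "\<dots> = real (t c j) / m c + ((real (t c j) - 1) / (m c + real (b c j))
          + real (t c j) / (real (t c j) * m c))"
      proof -
        have "real (t c j) * ((1 - 1 / real (t c j)) / (m c + real (b c j))) =
            (real (t c j) - 1) / (m c + real (b c j))"
          unfolding times_divide_eq_right right_diff_distrib using pos(1) by simp
        then show ?thesis unfolding distrib_left by simp
      qed
      finally have mids: "(\<Sum>y\<in>mids c j. g y y) = \<dots>" .
      have outs: "(\<Sum>y\<in>outs c j. g y y) = real (b c j) * (1 / m c +
          (1 / (real (t c j) * m c) + 1 / real (t c j)))"
        unfolding sum_outs by (simp add: card_Out c j)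
      show "(\<Sum>y\<in>mids c j. g y y) + (\<Sum>y\<in>outs c j. g y y) =
        (real (t c j) + real (b c j)) / m c + ((real (t c j) - 1) / (m c + real (b c j))
       + (real (t c j) + real (b c j)) / (real (t c j) * m c) + real (b c j) / real (t c j))"
        unfolding mids outs distrib_left add_divide_distrib by simp
    qed
    also have "\<dots> = gadget_trace (J c) (t c) (b c)"
      unfolding gadget_trace_def Let_def sum.distrib[of "\<lambda>j. (real (t c j) + real (b c j)) / m c"]
        sum_divide_distrib[symmetric] gadget_order_def[symmetric] ..
    finally show ?thesis .
  qed
  then show ?thesis
    unfolding sum_S[of "\<lambda>y. g y y"] by simp
qed

lemma card_S: "real (card S) = 1 + (\<Sum>c<C. gadget_order (J c) (t c) (b c)) + real l"
  using sum_S[of "\<lambda>_. 1"] by (simp add: card_blocks gadget_order_def)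

text \<open>Only block sizes and the path length enter the formula, so deleting a vertex amounts to
  changing one parameter.\<close>

theorem kirchhoff_index:
  "kirchhoff_index (induced adj S) =
     (1 + (\<Sum>c<C. gadget_order (J c) (t c) (b c)) + real l) *
       ((\<Sum>c<C. gadget_trace (J c) (t c) (b c)) + (\<Sum>i<l. real i + 1))
     - ((\<Sum>c<C. gadget_sum (J c) (t c) (b c)) + (\<Sum>i<l. \<Sum>i'<l. real (min i i') + 1))"
  unfolding card_S[symmetric] trace_g[symmetric] sum_sum_g[symmetric]
  by (rule kirchhoff_index_induced[where h = Hub]) (use symp_adj irreflp_adj green g_sym in auto)

end

section \<open>Deleting a vertex\<close>

context gadget_graph
begin

lemma connected: "Digraph_Component.connected (induced adj S)"
proof (rule connected_induced[OF Hub_in symp_adj])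
  fix x assume x: "x \<in> S"
  let ?R = "{(x, y). x \<in> S \<and> y \<in> S \<and> adj x y}"
  have mid: "(Mid c j i, Hub) \<in> ?R" if "Mid c j i \<in> S" for c j i
    using that by simp
  show "(x, Hub) \<in> ?R\<^sup>*"
  proof (cases x)
    case (Out c j i)
    then have c: "c < C" "j < J c" using x Out_bound by auto
    then have "card {i. Mid c j i \<in> S} > 0" using t_pos card_Mid by simp
    then obtain i' where i': "Mid c j i' \<in> S" by (auto simp: card_gt_0_iff)
    then have "(x, Mid c j i') \<in> ?R" using x Out by simp
    with mid[OF i'] show ?thesis by (meson converse_rtrancl_into_rtrancl r_into_rtrancl)
  next
    case (Tail i)
    have "Tail i \<in> S \<Longrightarrow> (Tail i, Hub) \<in> ?R\<^sup>*"
    proof (induction i)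
      case (Suc i)
      then have "Tail i \<in> S" by (simp add: Tail_iff)
      moreover from this have "(Tail (Suc i), Tail i) \<in> ?R" using Suc by simp
      ultimately show ?case using Suc.IH by (meson converse_rtrancl_into_rtrancl)
    qed auto
    then show ?thesis using x Tail by simp
  qed (use x mid in auto)
qed

text \<open>The bound \<open>2\<close> leaves the block a middle vertex, as the locale demands; it
  links the outer vertices of the block to the hub.\<close>

lemma delete_Mid:
  assumes v: "Mid c j i \<in> S" and t: "t c j \<ge> 2"
  shows "gadget_graph (S - {Mid c j i}) C J (t(c := (t c)(j := t c j - 1))) b l"
proof
  fix c' j'
  assume c': "c' < C" "j' < J c'"
  have eq: "{i'. Mid c' j' i' \<in> S - {Mid c j i}} =
      (if c' = c \<and> j' = j then {i'. Mid c j i' \<in> S} - {i} else {i. Mid c' j' i \<in> S})"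
    by auto
  show "card {i'. Mid c' j' i' \<in> S - {Mid c j i}} = (t(c := (t c)(j := t c j - 1))) c' j'"
    unfolding eq using v card_Mid[OF c'] by (cases "c' = c \<and> j' = j") auto
  show "0 < (t(c := (t c)(j := t c j - 1))) c' j'"
    using t_pos[OF c'] t by auto
qed (use Mid_bound Out_bound card_Out Tail_iff in auto)

lemma delete_Out:
  assumes v: "Out c j i \<in> S"
  shows "gadget_graph (S - {Out c j i}) C J t (b(c := (b c)(j := b c j - 1))) l"
proof
  fix c' j'
  assume c': "c' < C" "j' < J c'"
  have eq: "{i'. Out c' j' i' \<in> S - {Out c j i}} =
      (if c' = c \<and> j' = j then {i'. Out c j i' \<in> S} - {i} else {i. Out c' j' i \<in> S})"
    by auto
  show "card {i'. Out c' j' i' \<in> S - {Out c j i}} = (b(c := (b c)(j := b c j - 1))) c' j'"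
    unfolding eq using v card_Out[OF c'] by (cases "c' = c \<and> j' = j") auto
qed (use Mid_bound Out_bound card_Mid t_pos Tail_iff in auto)

text \<open>If the deletion raises \<open>T\<close> by \<open>\<delta>\<close> and lowers
  \<open>\<Sigma>\<close> by \<open>\<epsilon>\<close>, then \<open>n * T - \<Sigma> - ((n - 1) * (T
  + \<delta>) - (\<Sigma> - \<epsilon>)) = T - (n - 1) * \<delta> - \<epsilon>\<close>.\<close>

lemma kirchhoff_index_delete_Mid:
  fixes c j :: nat
  defines "t' \<equiv> (t c)(j := t c j - 1)"
  assumes v: "Mid c j i \<in> S" and t: "t c j \<ge> 2"
  shows "kirchhoff_index (induced adj S) - kirchhoff_index (induced adj (S - {Mid c j i})) =
    (\<Sum>c<C. gadget_trace (J c) (t c) (b c)) + (\<Sum>i<l. real i + 1)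
    - (real (card S) - 1) * (gadget_trace (J c) t' (b c) - gadget_trace (J c) (t c) (b c))
    - (gadget_sum (J c) (t c) (b c) - gadget_sum (J c) t' (b c))"
proof -
  interpret D: gadget_graph "S - {Mid c j i}" C J "t(c := t')" b l
    unfolding t'_def by (rule delete_Mid[OF v t])
  have c: "c < C" using v Mid_bound by simp
  \<comment> \<open>The sums over gadgets change in the single summand \<open>c\<close>.\<close>
  have upd: "(\<Sum>c'<C. F (J c') ((t(c := t')) c') (b c')) =
      (\<Sum>c'<C. F (J c') (t c') (b c')) - F (J c) (t c) (b c) + F (J c) t' (b c)"
    for F :: "nat \<Rightarrow> (nat \<Rightarrow> nat) \<Rightarrow> (nat \<Rightarrow> nat) \<Rightarrow> real"
    using c by (simp add: sum.remove[of "{..<C}" c])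
  have "card (S - {Mid c j i}) = card S - 1" using v by simp
  moreover have "card S > 0" using v by (auto simp: card_gt_0_iff)
  ultimately have card: "real (card (S - {Mid c j i})) = real (card S) - 1" by simp
  note D.kirchhoff_index[folded D.card_S, unfolded upd card]
  then show ?thesis
    unfolding kirchhoff_index card_S[symmetric] by (simp add: algebra_simps)
qed

lemma kirchhoff_index_delete_Out:
  fixes c j :: nat
  defines "b' \<equiv> (b c)(j := b c j - 1)"
  assumes v: "Out c j i \<in> S"
  shows "kirchhoff_index (induced adj S) - kirchhoff_index (induced adj (S - {Out c j i})) =
    (\<Sum>c<C. gadget_trace (J c) (t c) (b c)) + (\<Sum>i<l. real i + 1)
    - (real (card S) - 1) * (gadget_trace (J c) (t c) b' - gadget_trace (J c) (t c) (b c))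
    - (gadget_sum (J c) (t c) (b c) - gadget_sum (J c) (t c) b')"
proof -
  interpret D: gadget_graph "S - {Out c j i}" C J t "b(c := b')" l
    unfolding b'_def by (rule delete_Out[OF v])
  have c: "c < C" using v Out_bound by simp
  have upd: "(\<Sum>c'<C. F (J c') (t c') ((b(c := b')) c')) =
      (\<Sum>c'<C. F (J c') (t c') (b c')) - F (J c) (t c) (b c) + F (J c) (t c) b'"
    for F :: "nat \<Rightarrow> (nat \<Rightarrow> nat) \<Rightarrow> (nat \<Rightarrow> nat) \<Rightarrow> real"
    using c by (simp add: sum.remove[of "{..<C}" c])
  have "card (S - {Out c j i}) = card S - 1" using v by simp
  moreover have "card S > 0" using v by (auto simp: card_gt_0_iff)
  ultimately have card: "real (card (S - {Out c j i})) = real (card S) - 1" by simp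
  note D.kirchhoff_index[folded D.card_S, unfolded upd card]
  then show ?thesis
    unfolding kirchhoff_index card_S[symmetric] by (simp add: algebra_simps)
qed

end

definition full_gadgets ::
  "nat \<Rightarrow> (nat \<Rightarrow> nat) \<Rightarrow> (nat \<Rightarrow> nat \<Rightarrow> nat) \<Rightarrow> (nat \<Rightarrow> nat \<Rightarrow> nat) \<Rightarrow> nat \<Rightarrow> vertex set" where
  "full_gadgets C J t b l =
     {Hub} \<union> {Mid c j i | c j i. c < C \<and> j < J c \<and> i < t c j} \<union>
     {Out c j i | c j i. c < C \<and> j < J c \<and> i < b c j} \<union> Tail ` {..<l}"

lemma gadget_graph_full:
  assumes "\<And>c j. c < C \<Longrightarrow> j < J c \<Longrightarrow> t c j > 0"
  shows "gadget_graph (full_gadgets C J t b l) C J t b l"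
proof
  have "{Mid c j i | c j i. c < C \<and> j < J c \<and> i < t c j} =
      (\<Union>c\<in>{..<C}. \<Union>j\<in>{..<J c}. Mid c j ` {..<t c j})"
    "{Out c j i | c j i. c < C \<and> j < J c \<and> i < b c j} =
      (\<Union>c\<in>{..<C}. \<Union>j\<in>{..<J c}. Out c j ` {..<b c j})"
    by blast+
  then show "finite (full_gadgets C J t b l)" unfolding full_gadgets_def by simp
next
  fix c j assume c: "c < C" "j < J c"
  have "{i. Mid c j i \<in> full_gadgets C J t b l} = {..<t c j}"
    "{i. Out c j i \<in> full_gadgets C J t b l} = {..<b c j}"
    using c by (auto simp: full_gadgets_def)
  then show "card {i. Mid c j i \<in> full_gadgets C J t b l} = t c j"
    "card {i. Out c j i \<in> full_gadgets C J t b l} = b c j" by simp_all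
  show "0 < t c j" using assms c by simp
qed (auto simp: full_gadgets_def)

text \<open>
  \<open>gain\<close>, \<open>loss\<close> and \<open>excess\<close> are the constants \<open>\<alpha>\<close>, \<open>\<kappa>\<close> and \<open>\<zeta>\<close> of the introduction.
\<close>
definition gain :: "nat \<Rightarrow> real" where
  "gain s = gadget_trace 3 ((\<lambda>_. s + 1)(0 := s)) (\<lambda>_. s) - gadget_trace 3 (\<lambda>_. s + 1) (\<lambda>_. s)"

definition loss :: "nat \<Rightarrow> real" where
  "loss s = gadget_sum 3 (\<lambda>_. s + 1) (\<lambda>_. s) - gadget_sum 3 ((\<lambda>_. s + 1)(0 := s)) (\<lambda>_. s)"

definition excess :: "nat \<Rightarrow> real" where
  "excess s = 3 * (2 * real s + 1) * gain s - gadget_trace 3 (\<lambda>_. s + 1) (\<lambda>_. s)"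

lemma sum_lessThan_3: "(\<Sum>j<3. f j) = f 0 + f 1 + f (2 :: nat)" for f :: "nat \<Rightarrow> real"
  by (simp add: numeral_3_eq_3 numeral_2_eq_2)

lemma gadget_reindex:
  assumes "bij_betw p {..<J} {..<J}"
  shows "gadget_trace J (t \<circ> p) (b \<circ> p) = gadget_trace J t b"
    "gadget_sum J (t \<circ> p) (b \<circ> p) = gadget_sum J t b"
proof -
  note re = sum.reindex_bij_betw[OF assms]
  have m: "clique_order J (t \<circ> p) = clique_order J t"
    unfolding clique_order_def o_def using re[of "\<lambda>j. real (t j)"] by simp
  have N: "gadget_order J (t \<circ> p) (b \<circ> p) = gadget_order J t b"
    unfolding gadget_order_def o_def using re[of "\<lambda>j. real (t j) + real (b j)"] by simp
  show "gadget_trace J (t \<circ> p) (b \<circ> p) = gadget_trace J t b"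
    unfolding gadget_trace_def Let_def m N
    by (simp only: o_def re[of "\<lambda>j. (real (t j) - 1) / (clique_order J t + real (b j))
       + (real (t j) + real (b j)) / (real (t j) * clique_order J t) + real (b j) / real (t j)"])
  show "gadget_sum J (t \<circ> p) (b \<circ> p) = gadget_sum J t b"
    unfolding gadget_sum_def Let_def m N
    by (simp only: o_def re[of "\<lambda>j. (real (t j) + real (b j))\<^sup>2 / (real (t j) * clique_order J t)
       + real (b j) / real (t j)"])
qed

text \<open>The contributions are symmetric in the blocks, and \<open>p\<close> swaps
  \<open>0\<close> with \<open>j\<close>. One computation thus covers a deletion in any
  block.\<close>

lemma gadget_upd_first:
  assumes "j < J"
  shows "gadget_trace J ((\<lambda>_. x)(j := x')) ((\<lambda>_. y)(j := y')) = gadget_trace J ((\<lambda>_. x)(0 := x')) ((\<lambda>_. y)(0 := y'))"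
    "gadget_sum J ((\<lambda>_. x)(j := x')) ((\<lambda>_. y)(j := y')) = gadget_sum J ((\<lambda>_. x)(0 := x')) ((\<lambda>_. y)(0 := y'))"
proof -
  define p where "p i = (if i = 0 then j else if i = j then 0 else i)" for i
  have "bij_betw p {..<J} {..<J}"
    by (rule bij_betw_byWitness[of _ p]) (use assms in \<open>auto simp: p_def\<close>)
  moreover have "(\<lambda>_. z)(j := z') = (\<lambda>_. z)(0 := z') \<circ> p" for z z' :: nat
    by (auto simp: p_def fun_eq_iff)
  ultimately show "gadget_trace J ((\<lambda>_. x)(j := x')) ((\<lambda>_. y)(j := y')) = gadget_trace J ((\<lambda>_. x)(0 := x')) ((\<lambda>_. y)(0 := y'))"
    "gadget_sum J ((\<lambda>_. x)(j := x')) ((\<lambda>_. y)(j := y')) = gadget_sum J ((\<lambda>_. x)(0 := x')) ((\<lambda>_. y)(0 := y'))"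
    by (simp_all only: gadget_reindex)
qed

lemma const_upd: "(\<lambda>_. z)(i := z) = (\<lambda>_. z)"
  by auto

lemma gadget_modified_block:
  assumes "j < 3"
  shows "gadget_trace 3 ((\<lambda>_. s + 1)(j := s)) (\<lambda>_. s) = gadget_trace 3 ((\<lambda>_. s + 1)(0 := s)) (\<lambda>_. s)"
    "gadget_sum 3 ((\<lambda>_. s + 1)(j := s)) (\<lambda>_. s) = gadget_sum 3 ((\<lambda>_. s + 1)(0 := s)) (\<lambda>_. s)"
    "gadget_trace 3 (\<lambda>_. s + 1) ((\<lambda>_. s)(j := s - 1)) = gadget_trace 3 (\<lambda>_. s + 1) ((\<lambda>_. s)(0 := s - 1))"
    "gadget_sum 3 (\<lambda>_. s + 1) ((\<lambda>_. s)(j := s - 1)) = gadget_sum 3 (\<lambda>_. s + 1) ((\<lambda>_. s)(0 := s - 1))"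
  using gadget_upd_first[OF assms, of "s + 1" s s s] gadget_upd_first[OF assms, of "s + 1" "s + 1" s "s - 1"]
  by (simp_all only: const_upd)

section \<open>Explicit values for three blocks, before and after a deletion\<close>

lemma gadget_trace_full:
  "gadget_trace 3 (\<lambda>_. s + 1) (\<lambda>_. s) =
   3 * (2 * real s + 1) / (3 * real s + 4) + ((real s / (4 * real s + 4) + (2 * real s + 1) / ((real s + 1) * (3 * real s + 4)) + real s / (real s + 1))
     + 2 * (real s / (4 * real s + 4) + (2 * real s + 1) / ((real s + 1) * (3 * real s + 4)) + real s / (real s + 1)))"
proof -
  have m: "clique_order 3 (\<lambda>_. s + 1) = 3 * real s + 4"
    by (simp add: clique_order_def sum_lessThan_3)
  have N: "gadget_order 3 (\<lambda>_. s + 1) (\<lambda>_. s) = 3 * (2 * real s + 1)"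
    by (simp add: gadget_order_def sum_lessThan_3 of_nat_diff)
  have "x + y + y = x + 2 * y" "0 < (1::nat)" "(1::nat) \<noteq> 0" "(2::nat) \<noteq> 0" "real (s + 1) = real s + 1"
    "real s + 1 - 1 = real s" "real s + 1 + real s = 2 * real s + 1" "real s + real s = 2 * real s" "3 * real s + 4 + real s = 4 * real s + 4" for x y :: real
    by (simp_all add: of_nat_diff)
  then show ?thesis
    unfolding gadget_trace_def Let_def m N sum_lessThan_3 by (simp only: fun_upd_apply if_True if_False simp_thms)
qed

lemma gadget_trace_less_Mid:
  "gadget_trace 3 ((\<lambda>_. s + 1)(0 := s)) (\<lambda>_. s) =
   (6 * real s + 2) / (3 * real s + 3)
     + (((real s - 1) / (4 * real s + 3) + 2 * real s / (real s * (3 * real s + 3)) + real s / real s)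
     + 2 * (real s / (4 * real s + 3) + (2 * real s + 1) / ((real s + 1) * (3 * real s + 3)) + real s / (real s + 1)))"
proof -
  have m: "clique_order 3 ((\<lambda>_. s + 1)(0 := s)) = 3 * real s + 3"
    by (simp add: clique_order_def sum_lessThan_3)
  have N: "gadget_order 3 ((\<lambda>_. s + 1)(0 := s)) (\<lambda>_. s) = 6 * real s + 2"
    by (simp add: gadget_order_def sum_lessThan_3 of_nat_diff)
  have "x + y + y = x + 2 * y" "0 < (1::nat)" "(1::nat) \<noteq> 0" "(2::nat) \<noteq> 0" "real (s + 1) = real s + 1"
    "real s + 1 - 1 = real s" "real s + 1 + real s = 2 * real s + 1" "real s + real s = 2 * real s" "3 * real s + 3 + real s = 4 * real s + 3" for x y :: real
    by (simp_all add: of_nat_diff)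
  then show ?thesis
    unfolding gadget_trace_def Let_def m N sum_lessThan_3 by (simp only: fun_upd_apply if_True if_False simp_thms)
qed

lemma gadget_sum_full:
  "gadget_sum 3 (\<lambda>_. s + 1) (\<lambda>_. s) =
   (3 * (2 * real s + 1))\<^sup>2 / (3 * real s + 4) + (((2 * real s + 1)\<^sup>2 / ((real s + 1) * (3 * real s + 4)) + real s / (real s + 1))
     + 2 * ((2 * real s + 1)\<^sup>2 / ((real s + 1) * (3 * real s + 4)) + real s / (real s + 1)))"
proof -
  have m: "clique_order 3 (\<lambda>_. s + 1) = 3 * real s + 4"
    by (simp add: clique_order_def sum_lessThan_3)
  have N: "gadget_order 3 (\<lambda>_. s + 1) (\<lambda>_. s) = 3 * (2 * real s + 1)"
    by (simp add: gadget_order_def sum_lessThan_3 of_nat_diff)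
  have "x + y + y = x + 2 * y" "0 < (1::nat)" "(1::nat) \<noteq> 0" "(2::nat) \<noteq> 0" "real (s + 1) = real s + 1"
    "real s + 1 - 1 = real s" "real s + 1 + real s = 2 * real s + 1" "real s + real s = 2 * real s" for x y :: real
    by (simp_all add: of_nat_diff)
  then show ?thesis
    unfolding gadget_sum_def Let_def m N sum_lessThan_3 by (simp only: fun_upd_apply if_True if_False simp_thms)
qed

lemma gadget_sum_less_Mid:
  "gadget_sum 3 ((\<lambda>_. s + 1)(0 := s)) (\<lambda>_. s) =
   (6 * real s + 2)\<^sup>2 / (3 * real s + 3) + (((2 * real s)\<^sup>2 / (real s * (3 * real s + 3)) + real s / real s)
     + 2 * ((2 * real s + 1)\<^sup>2 / ((real s + 1) * (3 * real s + 3)) + real s / (real s + 1)))"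
proof -
  have m: "clique_order 3 ((\<lambda>_. s + 1)(0 := s)) = 3 * real s + 3"
    by (simp add: clique_order_def sum_lessThan_3)
  have N: "gadget_order 3 ((\<lambda>_. s + 1)(0 := s)) (\<lambda>_. s) = 6 * real s + 2"
    by (simp add: gadget_order_def sum_lessThan_3 of_nat_diff)
  have "x + y + y = x + 2 * y" "0 < (1::nat)" "(1::nat) \<noteq> 0" "(2::nat) \<noteq> 0" "real (s + 1) = real s + 1"
    "real s + 1 - 1 = real s" "real s + 1 + real s = 2 * real s + 1" "real s + real s = 2 * real s" for x y :: real
    by (simp_all add: of_nat_diff)
  then show ?thesis
    unfolding gadget_sum_def Let_def m N sum_lessThan_3 by (simp only: fun_upd_apply if_True if_False simp_thms)
qed

lemma gadget_trace_less_Out: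
  assumes "s \<ge> 1"
  shows "gadget_trace 3 (\<lambda>_. s + 1) ((\<lambda>_. s)(0 := s - 1)) =
   (6 * real s + 2) / (3 * real s + 4)
     + ((real s / (4 * real s + 3) + 2 * real s / ((real s + 1) * (3 * real s + 4)) + (real s - 1) / (real s + 1))
     + 2 * (real s / (4 * real s + 4) + (2 * real s + 1) / ((real s + 1) * (3 * real s + 4)) + real s / (real s + 1)))"
proof -
  have m: "clique_order 3 (\<lambda>_. s + 1) = 3 * real s + 4"
    by (simp add: clique_order_def sum_lessThan_3)
  have N: "gadget_order 3 (\<lambda>_. s + 1) ((\<lambda>_. s)(0 := s - 1)) = 6 * real s + 2"
    using assms by (simp add: gadget_order_def sum_lessThan_3 of_nat_diff)
  have "x + y + y = x + 2 * y" "0 < (1::nat)" "(1::nat) \<noteq> 0" "(2::nat) \<noteq> 0" "real (s + 1) = real s + 1"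
    "real s + 1 - 1 = real s" "real s + 1 + real s = 2 * real s + 1" "real s + real s = 2 * real s" "3 * real s + 4 + real s = 4 * real s + 4"
    "real (s - 1) = real s - 1" "real s + 1 + (real s - 1) = 2 * real s" "3 * real s + 4 + (real s - 1) = 4 * real s + 3" for x y :: real
    using assms by (simp_all add: of_nat_diff)
  then show ?thesis
    unfolding gadget_trace_def Let_def m N sum_lessThan_3 by (simp only: fun_upd_apply if_True if_False simp_thms)
qed

lemma gadget_sum_less_Out:
  assumes "s \<ge> 1"
  shows "gadget_sum 3 (\<lambda>_. s + 1) ((\<lambda>_. s)(0 := s - 1)) =
   (6 * real s + 2)\<^sup>2 / (3 * real s + 4) + (((2 * real s)\<^sup>2 / ((real s + 1) * (3 * real s + 4)) + (real s - 1) / (real s + 1))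
     + 2 * ((2 * real s + 1)\<^sup>2 / ((real s + 1) * (3 * real s + 4)) + real s / (real s + 1)))"
proof -
  have m: "clique_order 3 (\<lambda>_. s + 1) = 3 * real s + 4"
    by (simp add: clique_order_def sum_lessThan_3)
  have N: "gadget_order 3 (\<lambda>_. s + 1) ((\<lambda>_. s)(0 := s - 1)) = 6 * real s + 2"
    using assms by (simp add: gadget_order_def sum_lessThan_3 of_nat_diff)
  have "x + y + y = x + 2 * y" "0 < (1::nat)" "(1::nat) \<noteq> 0" "(2::nat) \<noteq> 0" "real (s + 1) = real s + 1"
    "real s + 1 - 1 = real s" "real s + 1 + real s = 2 * real s + 1" "real s + real s = 2 * real s"
    "real (s - 1) = real s - 1" "real s + 1 + (real s - 1) = 2 * real s" "3 * real s + 4 + (real s - 1) = 4 * real s + 3" for x y :: real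
    using assms by (simp_all add: of_nat_diff)
  then show ?thesis
    unfolding gadget_sum_def Let_def m N sum_lessThan_3 by (simp only: fun_upd_apply if_True if_False simp_thms)
qed

text \<open>Over the common denominator \<open>D\<close> all coefficients of the numerators are
  positive, so that rationality and signs can be read off. The last quantity is needed for outer
  vertices: there \<open>n - 1\<close> is replaced by \<open>3 * (2 * x + 1)\<close>, the order of
  one gadget without the hub.\<close>

lemma gadget_estimates:
  assumes s: "s \<ge> 1"
  defines "x \<equiv> real s"
  defines "D \<equiv> 12 * (3 * x + 4) * (x + 1)\<^sup>2 * (4 * x + 3)"
  shows "gain s = (168 + 576 * x + 599 * x\<^sup>2 + 183 * x ^ 3) / D"
    and "excess s = (288 + 1152 * x + 1824 * x\<^sup>2 + 1254 * x ^ 3 + 270 * x ^ 4) / D"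
    and "loss s = (96 * x + 200 * x\<^sup>2 + 96 * x ^ 3) / D"
    and "gadget_trace 3 (\<lambda>_. s + 1) (\<lambda>_. s) - gadget_trace 3 (\<lambda>_. s + 1) ((\<lambda>_. s)(0 := s - 1))
      = (216 + 636 * x + 603 * x\<^sup>2 + 183 * x ^ 3) / D"
    and "3 * (2 * x + 1) * (gadget_trace 3 (\<lambda>_. s + 1) (\<lambda>_. s) - gadget_trace 3 (\<lambda>_. s + 1) ((\<lambda>_. s)(0 := s - 1)))
      - (gadget_sum 3 (\<lambda>_. s + 1) (\<lambda>_. s) - gadget_sum 3 (\<lambda>_. s + 1) ((\<lambda>_. s)(0 := s - 1))) + loss s
      = (288 + 1596 * x + 2897 * x\<^sup>2 + 2103 * x ^ 3 + 522 * x ^ 4) / D"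
proof -
  \<comment> \<open>Treating the reciprocals as variables subject to \<open>rel\<close> turns
    identities of fractions into polynomial identities.\<close>
  define P Q R where "P = 1 / (3 * x + 4)" and "Q = 1 / (x + 1)" and "R = 1 / (4 * x + 3)"
  have x: "x > 0" using s by (simp add: x_def)
  have rel: "P * (3 * x + 4) = 1" "Q * (x + 1) = 1" "R * (4 * x + 3) = 1"
    using x by (simp_all add: P_def Q_def R_def)
  have e: "3 * x + 3 = 3 * (x + 1)" "4 * x + 4 = 4 * (x + 1)" by simp_all
  have fracs: "x / x = 1" "2 * x / (x * (3 * (x + 1))) = 2 * Q / 3" "(2 * x)\<^sup>2 / (x * (3 * (x + 1))) = 4 * x * Q / 3"
      "a / (3 * (x + 1)) = a * Q / 3" "a / (4 * (x + 1)) = a * Q / 4"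
      "a / ((x + 1) * (3 * (x + 1))) = a * Q * Q / 3" "a / ((x + 1) * (3 * x + 4)) = a * Q * P"
      "a / (x + 1) = a * Q" "a / (3 * x + 4) = a * P" "a / (4 * x + 3) = a * R" for a
    unfolding P_def Q_def R_def using x by (simp_all add: power2_eq_square)
  have D: "a / D = a * P * Q\<^sup>2 * R / 12" for a
    unfolding P_def Q_def R_def D_def by (simp add: power2_eq_square algebra_simps)
  note simps = gadget_trace_full gadget_trace_less_Mid gadget_sum_full gadget_sum_less_Mid
    gadget_trace_less_Out[OF s] gadget_sum_less_Out[OF s] gain_def loss_def excess_def
    x_def[symmetric] e fracs D
  show "gain s = (168 + 576 * x + 599 * x\<^sup>2 + 183 * x ^ 3) / D"
    unfolding simps using rel by algebra
  show "excess s = (288 + 1152 * x + 1824 * x\<^sup>2 + 1254 * x ^ 3 + 270 * x ^ 4) / D"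
    unfolding simps using rel by algebra
  show loss_eq: "loss s = (96 * x + 200 * x\<^sup>2 + 96 * x ^ 3) / D"
    unfolding simps using rel by algebra
  have trace_Out: "gadget_trace 3 (\<lambda>_. s + 1) (\<lambda>_. s) - gadget_trace 3 (\<lambda>_. s + 1) ((\<lambda>_. s)(0 := s - 1))
      = P + Q * P + Q + x * Q / 4 - x * R"
    by (simp only: simps) (simp add: algebra_simps)
  have sum_Out: "gadget_sum 3 (\<lambda>_. s + 1) (\<lambda>_. s) - gadget_sum 3 (\<lambda>_. s + 1) ((\<lambda>_. s)(0 := s - 1))
      = (12 * x + 5) * P + (4 * x + 1) * Q * P + Q"
    by (simp only: simps) (simp add: algebra_simps power2_eq_square)
  \<comment> \<open>\<open>W\<close> is \<open>12 / D\<close>. All reciprocals become polynomial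
    multiples of it, which leaves identities in \<open>x\<close> and \<open>W\<close> alone.\<close>
  define W where "W = P * Q\<^sup>2 * R"
  have W: "P = (x + 1)\<^sup>2 * (4 * x + 3) * W" "Q * P = (x + 1) * (4 * x + 3) * W"
    "Q = (3 * x + 4) * (x + 1) * (4 * x + 3) * W" "R = (3 * x + 4) * (x + 1)\<^sup>2 * W"
    unfolding W_def using rel by algebra+
  have DW: "a / D = a * W / 12" for a by (simp add: D W_def)
  show trace_eq: "gadget_trace 3 (\<lambda>_. s + 1) (\<lambda>_. s) - gadget_trace 3 (\<lambda>_. s + 1) ((\<lambda>_. s)(0 := s - 1))
      = (216 + 636 * x + 603 * x\<^sup>2 + 183 * x ^ 3) / D"
    unfolding trace_Out DW using W by algebra
  show "3 * (2 * x + 1) * (gadget_trace 3 (\<lambda>_. s + 1) (\<lambda>_. s) - gadget_trace 3 (\<lambda>_. s + 1) ((\<lambda>_. s)(0 := s - 1)))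
      - (gadget_sum 3 (\<lambda>_. s + 1) (\<lambda>_. s) - gadget_sum 3 (\<lambda>_. s + 1) ((\<lambda>_. s)(0 := s - 1))) + loss s
      = (288 + 1596 * x + 2897 * x\<^sup>2 + 2103 * x ^ 3 + 522 * x ^ 4) / D"
    unfolding trace_eq sum_Out loss_eq unfolding DW using W by algebra
qed

section \<open>Balancing\<close>

lemma Rats_common_denominator:
  fixes x y z :: real
  assumes "x \<in> \<rat>" "y \<in> \<rat>" "z \<in> \<rat>"
  obtains q :: nat and a b c :: int where "q \<ge> 1" "real q * x = of_int a" "real q * y = of_int b" "real q * z = of_int c"
proof -
  have *: "\<exists>q::nat. q \<ge> 1 \<and> (\<exists>p::int. real q * w = of_int p)" if w: "w \<in> \<rat>" for w :: real
  proof -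
    obtain a b :: int where "b > 0" "w = of_int a / of_int b"
      using w by (elim Rats_cases') auto
    then have "nat b \<ge> 1 \<and> real (nat b) * w = of_int a" by simp
    then show ?thesis by blast
  qed
  obtain q1 p1 where 1: "q1 \<ge> 1" "real q1 * x = of_int p1" using *[OF assms(1)] by blast
  obtain q2 p2 where 2: "q2 \<ge> 1" "real q2 * y = of_int p2" using *[OF assms(2)] by blast
  obtain q3 p3 where 3: "q3 \<ge> 1" "real q3 * z = of_int p3" using *[OF assms(3)] by blast
  show thesis
  proof (rule that[of "q1 * q2 * q3" "p1 * int q2 * int q3" "p2 * int q1 * int q3" "p3 * int q1 * int q2"])
    show "q1 * q2 * q3 \<ge> 1" using 1 2 3 by simp
    show "real (q1 * q2 * q3) * x = of_int (p1 * int q2 * int q3)" using 1(2)[symmetric] by simp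
    show "real (q1 * q2 * q3) * y = of_int (p2 * int q1 * int q3)" using 2(2)[symmetric] by simp
    show "real (q1 * q2 * q3) * z = of_int (p3 * int q1 * int q2)" using 3(2)[symmetric] by simp
  qed
qed

text \<open>
  Over a common denominator \<open>q\<close>, a filler clique of order \<open>2 * q\<close> with \<open>f\<close> leaves hung on one of its
  vertices shifts the balance by multiples of \<open>1 / q\<close>; the number \<open>a\<close> of leaves at the hub is chosen
  with \<open>f + a\<close> fixed, so that varying \<open>f\<close> reaches every residue class modulo \<open>\<zeta>\<close>.
\<close>
lemma balancing_parameters:
  fixes \<alpha> \<zeta> \<kappa> :: real
  assumes rats: "\<alpha> \<in> \<rat>" "\<zeta> \<in> \<rat>" "\<kappa> \<in> \<rat>" and \<zeta>: "\<zeta> > 0"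
  obtains q f a :: nat and k l :: "nat \<Rightarrow> nat"
  where "q \<ge> 1" "mono k" "strict_mono l" "\<And>i. k i \<ge> 1"
    and "\<And>i. real (k i) * \<zeta> = (2 * real q - 1 + real f) / real q + real f - \<alpha> * (2 * real q - 1 + real f)
      + real a * (1 - \<alpha>) + real (l i) * (real (l i) + 1) / 2 - \<alpha> * real (l i) - \<kappa>"
    and "\<And>c. (\<lambda>i. (c + real (l i)) / real (k i)) \<longlonglongrightarrow> 0"
proof -
  obtain q A Z' K where q: "q \<ge> 1" and A: "real q * \<alpha> = of_int A" and Z': "real q * \<zeta> = of_int Z'"
    and K: "real q * \<kappa> = of_int K"
    using Rats_common_denominator[OF rats] by metis
  have "(of_int Z' :: real) > 0" unfolding Z'[symmetric] using q \<zeta> by simp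
  then have Z'_pos: "Z' > 0" by simp
  define Z where "Z = nat Z'"
  have Z: "Z \<ge> 1" "real q * \<zeta> = real Z" "Z' = int Z" using Z'_pos Z' by (simp_all add: Z_def)
  \<comment> \<open>\<open>r\<close> is the part of \<open>q\<close> times the right-hand side of
    the balance equation that is free of \<open>f\<close>, \<open>a\<close> and
    \<open>l\<close>.\<close>
  define r where "r = (2 * int q - 1) * (1 - A) - K"
  define f where "f = nat ((- r) mod int Z)"
  have f: "int f = (- r) mod int Z" "f < Z" using Z(1) by (simp_all add: f_def nat_less_iff)
  have "int Z dvd int f + r"
    unfolding f(1) by (metis add.right_inverse dvd_0_right dvd_eq_mod_eq_0 mod_add_left_eq add.commute)
  then obtain e where e: "int f + r = int Z * e" by (elim dvdE)
  \<comment> \<open>With \<open>f + a = Z\<close>, the terms in \<open>f\<close> and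
    \<open>a\<close> add up to \<open>f + Z * (q - A)\<close>; modulo \<open>Z\<close>, only
    \<open>f\<close> remains, and it cancels \<open>r\<close>.\<close>
  define a where "a = Z - f"
  define e' where "e' = e + int q - A"
  \<comment> \<open>The offset makes \<open>I\<close> large enough for \<open>k'\<close> to be
    monotone and at least the square of \<open>I\<close>.\<close>
  define I where "I i = 2 * nat \<bar>A\<bar> + nat \<bar>e'\<bar> + 1 + i" for i
  \<comment> \<open>The factor \<open>2 * Z\<close> makes both \<open>l\<close> and
    \<open>l * (l + 1) / 2\<close> divisible by \<open>Z\<close>.\<close>
  define l where "l i = 2 * Z * I i" for i
  \<comment> \<open>This is the balance equation solved for the number of copies, after division by
    \<open>Z\<close>.\<close>
  define k' where "k' i = e' + int q * int (I i) * (2 * int Z * int (I i) + 1) - 2 * A * int (I i)" for i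
  define k where "k i = nat (k' i)" for i
  have I_ge: "int (I i) \<ge> 2 * \<bar>A\<bar> + \<bar>e'\<bar> + 1 + int i" for i by (simp add: I_def)
  have I_Suc: "I (Suc i) = Suc (I i)" for i by (simp add: I_def)
  have k'_ge: "k' i \<ge> (int (I i))\<^sup>2" for i
  proof -
    have "1 * int (I i) * (2 * 1 * int (I i) + 1) \<le> int q * int (I i) * (2 * int Z * int (I i) + 1)"
      using q Z(1) by (intro mult_mono add_mono) auto
    moreover have "2 * A * int (I i) \<le> int (I i) * int (I i)"
      using I_ge[of i] by (intro mult_right_mono) auto
    ultimately show ?thesis
      using I_ge[of i] unfolding k'_def power2_eq_square by (simp add: algebra_simps)
  qed
  have k'_Suc: "k' i \<le> k' (Suc i)" for i
  proof -
    have "1 * (2 * 1 * int (I i)) \<le> int q * (2 * int Z * int (I i))"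
      using q Z(1) by (intro mult_mono) auto
    then have "A \<le> int q * (2 * int Z * int (I i))" using I_ge[of i] by simp
    moreover have "0 \<le> int q * (2 * int Z + 1)" by simp
    moreover have "k' (Suc i) - k' i = 2 * (int q * (2 * int Z * int (I i))) + int q * (2 * int Z + 1) - 2 * A"
      unfolding k'_def I_Suc by (simp add: algebra_simps)
    ultimately show ?thesis by linarith
  qed
  have k: "int (k i) = k' i" for i
    using k'_ge[of i] order_trans[OF zero_le_power2] by (auto simp: k_def)
  show thesis
  proof (rule that[of q k l f a])
    show "q \<ge> 1" by (rule q)
    show "mono k"
      using k'_Suc k by (intro mono_iff_le_Suc[THEN iffD2]) (metis of_nat_le_iff)
    show "strict_mono l"
      using Z(1) by (intro strict_mono_Suc_iff[THEN iffD2]) (simp add: l_def I_Suc)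
    have k_ge: "real (k i) \<ge> (real (I i))\<^sup>2" for i
    proof -
      have "int ((I i)\<^sup>2) \<le> int (k i)" using k'_ge[of i] k[of i] by simp
      then show ?thesis by (metis of_nat_le_iff of_nat_power)
    qed
    have I_pos: "real (I i) \<ge> 1 + real i" for i by (simp add: I_def)
    have k_ge': "real (k i) \<ge> (1 + real i)\<^sup>2" for i
      by (rule order_trans[OF power_mono[OF I_pos] k_ge]) simp
    show "k i \<ge> 1" for i
    proof -
      have "(1 + real i)\<^sup>2 \<ge> 1" by (simp add: one_le_power)
      then have "real (k i) \<ge> 1" by (rule order_trans[OF _ k_ge'])
      then show ?thesis by simp
    qed
    show "real (k i) * \<zeta> = (2 * real q - 1 + real f) / real q + real f - \<alpha> * (2 * real q - 1 + real f)
      + real a * (1 - \<alpha>) + real (l i) * (real (l i) + 1) / 2 - \<alpha> * real (l i) - \<kappa>" for i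
    proof -
      have ki: "real (k i) = of_int e' + real q * real (I i) * (2 * real Z * real (I i) + 1)
          - 2 * of_int A * real (I i)"
      proof -
        have "real (k i) = of_int (k' i)" using k[of i] by (metis of_int_of_nat_eq)
        then show ?thesis by (simp add: k'_def)
      qed
      have er: "real f + ((2 * real q - 1) * (1 - of_int A) - of_int K) = real Z * of_int e"
        using arg_cong[OF e, of real_of_int] by (simp add: r_def)
      have half: "real (l i) * (real (l i) + 1) / 2 = real Z * real (I i) * (2 * real Z * real (I i) + 1)"
        by (simp add: l_def)
      have ar: "real a = real Z - real f" using f(2) by (simp add: a_def)
      have "real q * (real (k i) * \<zeta>) = real Z * real (k i)" using Z(2) by (simp add: algebra_simps)
      also have "\<dots> = (2 * real q - 1 + real f) + real q * real f - of_int A * (2 * real q - 1 + real f)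
        + real a * (real q - of_int A) + real q * (real (l i) * (real (l i) + 1) / 2)
        - of_int A * real (l i) - of_int K"
        using er unfolding ki ar half unfolding l_def e'_def by (simp add: algebra_simps)
      also have "\<dots> = real q * ((2 * real q - 1 + real f) / real q + real f - \<alpha> * (2 * real q - 1 + real f)
      + real a * (1 - \<alpha>) + real (l i) * (real (l i) + 1) / 2 - \<alpha> * real (l i) - \<kappa>)"
      proof -
        have "real q * ((2 * real q - 1 + real f) / real q) = 2 * real q - 1 + real f" using q by simp
        then show ?thesis
          unfolding A[symmetric] K[symmetric] distrib_left right_diff_distrib by simp
      qed
      finally show ?thesis using q by simp
    qed
    \<comment> \<open>\<open>l\<close> is linear in \<open>I\<close>, while \<open>k\<close> is at
      least quadratic.\<close>
    show "(\<lambda>i. (c + real (l i)) / real (k i)) \<longlonglongrightarrow> 0" for c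
    proof (rule tendsto_0_le[where K = 1])
      show "\<forall>\<^sub>F i in sequentially. norm ((c + real (l i)) / real (k i)) \<le>
          norm ((\<bar>c\<bar> + 2 * real Z) / (1 + real i)) * 1"
      proof (intro always_eventually allI)
        fix i
        have I0: "real (I i) \<ge> 1" using I_pos[of i] by simp
        have "\<bar>c + real (l i)\<bar> \<le> \<bar>c\<bar> + 2 * real Z * real (I i)"
          using abs_triangle_ineq[of c "real (l i)"] by (simp add: l_def)
        also have "\<dots> \<le> (\<bar>c\<bar> + 2 * real Z) * real (I i)"
          using mult_left_mono[OF I0, of "\<bar>c\<bar>"] by (simp add: algebra_simps)
        finally have "norm ((c + real (l i)) / real (k i)) \<le> (\<bar>c\<bar> + 2 * real Z) * real (I i) / (real (I i))\<^sup>2"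
          using k_ge[of i] I0 by (simp add: frac_le)
        also have "\<dots> = (\<bar>c\<bar> + 2 * real Z) / real (I i)" using I0 by (simp add: power2_eq_square)
        also have "\<dots> \<le> (\<bar>c\<bar> + 2 * real Z) / (1 + real i)"
          using I_pos[of i] by (intro divide_left_mono) auto
        finally show "norm ((c + real (l i)) / real (k i)) \<le> norm ((\<bar>c\<bar> + 2 * real Z) / (1 + real i)) * 1"
          by simp
      qed
      show "(\<lambda>i. (\<bar>c\<bar> + 2 * real Z) / (1 + real i)) \<longlonglongrightarrow> 0"
        by (rule real_tendsto_divide_at_top[OF tendsto_const])
          (rule filterlim_tendsto_add_at_top[OF tendsto_const filterlim_real_sequentially])
    qed
  qed
qed

lemma gadget_estimates_pos:
  assumes s: "s \<ge> 1"
  shows "gain s > 0" "excess s > 0"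
    and "gadget_trace 3 (\<lambda>_. s + 1) (\<lambda>_. s) - gadget_trace 3 (\<lambda>_. s + 1) ((\<lambda>_. s)(0 := s - 1)) > 0"
    and "3 * (2 * real s + 1) * (gadget_trace 3 (\<lambda>_. s + 1) (\<lambda>_. s) - gadget_trace 3 (\<lambda>_. s + 1) ((\<lambda>_. s)(0 := s - 1)))
      - (gadget_sum 3 (\<lambda>_. s + 1) (\<lambda>_. s) - gadget_sum 3 (\<lambda>_. s + 1) ((\<lambda>_. s)(0 := s - 1))) + loss s > 0"
proof -
  have D: "12 * (3 * real s + 4) * (real s + 1)\<^sup>2 * (4 * real s + 3) > 0"
    by (intro mult_pos_pos zero_less_power add_nonneg_pos) simp_all
  show "gain s > 0"
    unfolding gadget_estimates(1)[OF s] by (intro divide_pos_pos[OF _ D] add_pos_nonneg) simp_all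
  show "excess s > 0"
    unfolding gadget_estimates(2)[OF s] by (intro divide_pos_pos[OF _ D] add_pos_nonneg) simp_all
  show "gadget_trace 3 (\<lambda>_. s + 1) (\<lambda>_. s) - gadget_trace 3 (\<lambda>_. s + 1) ((\<lambda>_. s)(0 := s - 1)) > 0"
    unfolding gadget_estimates(4)[OF s] by (intro divide_pos_pos[OF _ D] add_pos_nonneg) simp_all
  show "3 * (2 * real s + 1) * (gadget_trace 3 (\<lambda>_. s + 1) (\<lambda>_. s) - gadget_trace 3 (\<lambda>_. s + 1) ((\<lambda>_. s)(0 := s - 1)))
      - (gadget_sum 3 (\<lambda>_. s + 1) (\<lambda>_. s) - gadget_sum 3 (\<lambda>_. s + 1) ((\<lambda>_. s)(0 := s - 1))) + loss s > 0"
    unfolding gadget_estimates(5)[OF s] by (intro divide_pos_pos[OF _ D] add_pos_nonneg) simp_all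
qed

section \<open>The balanced graphs and their good vertices\<close>

text \<open>\<open>balance\<close> is the equation \<open>T = \<alpha> * (n - 1) + \<kappa>\<close>
  with the terms of the \<open>k\<close> copies collected on the left. On the right follow the
  filler, the \<open>a\<close> leaves at the hub, the path, and the constant.\<close>

locale balanced_family =
  fixes s q f a k l :: nat
  assumes s: "s \<ge> 1" and q: "q \<ge> 1" and k: "k \<ge> 1"
    and balance: "real k * excess s = (2 * real q - 1 + real f) / real q + real f
      - gain s * (2 * real q - 1 + real f) + real a * (1 - gain s)
      + real l * (real l + 1) / 2 - gain s * real l - loss s"
begin

text \<open>Gadgets below \<open>k\<close> are the copies and gadget \<open>k\<close> is the filler:
  \<open>2 * q - 1\<close> blocks of one middle vertex, hence a clique of order \<open>2 * q\<close>
  with the hub, and \<open>f\<close> leaves on block \<open>0\<close>. Each later gadget is a single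
  leaf at the hub.\<close>

definition J :: "nat \<Rightarrow> nat" where
  "J c = (if c < k then 3 else if c = k then 2 * q - 1 else 1)"

definition t :: "nat \<Rightarrow> nat \<Rightarrow> nat" where
  "t c = (if c < k then (\<lambda>_. s + 1) else (\<lambda>_. 1))"

definition b :: "nat \<Rightarrow> nat \<Rightarrow> nat" where
  "b c = (if c < k then (\<lambda>_. s) else if c = k then (\<lambda>j. if j = 0 then f else 0) else (\<lambda>_. 0))"

definition V :: "vertex set" where "V = full_gadgets (k + 1 + a) J t b l"

sublocale gadget_graph V "k + 1 + a" J t b l
  unfolding V_def by (rule gadget_graph_full) (simp add: t_def)

lemma sum_gadgets:
  "(\<Sum>c<k + 1 + a. F (J c) (t c) (b c)) = real k * F 3 (\<lambda>_. s + 1) (\<lambda>_. s)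
    + F (2 * q - 1) (\<lambda>_. 1) ((\<lambda>j. if j = 0 then f else 0)) + real a * F 1 (\<lambda>_. 1) (\<lambda>_. 0)"
  for F :: "nat \<Rightarrow> (nat \<Rightarrow> nat) \<Rightarrow> (nat \<Rightarrow> nat) \<Rightarrow> real"
proof -
  have "(\<Sum>c<k + 1 + a'. F (J c) (t c) (b c)) = real k * F 3 (\<lambda>_. s + 1) (\<lambda>_. s)
    + F (2 * q - 1) (\<lambda>_. 1) ((\<lambda>j. if j = 0 then f else 0)) + real a' * F 1 (\<lambda>_. 1) (\<lambda>_. 0)" for a'
  proof (induction a')
    case 0
    have "(\<Sum>c<k. F (J c) (t c) (b c)) = (\<Sum>c<k. F 3 (\<lambda>_. s + 1) (\<lambda>_. s))"
      by (intro sum.cong refl) (simp add: J_def t_def b_def)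
    then show ?case by (simp add: J_def t_def b_def)
  next
    case (Suc a')
    then show ?case by (simp add: J_def t_def b_def algebra_simps)
  qed
  then show ?thesis .
qed

lemma sum_filler_leaves: "(\<Sum>j<2 * q - 1. real (if j = 0 then f else 0)) = real f"
  using q by (simp add: if_distrib cong: if_cong)

lemma order_filler: "gadget_order (2 * q - 1) (\<lambda>_. 1) ((\<lambda>j. if j = 0 then f else 0)) = 2 * real q - 1 + real f"
  using q unfolding gadget_order_def sum.distrib sum_filler_leaves by (simp add: of_nat_diff)

text \<open>Blocks with one middle vertex have no \<open>t - 1\<close> term. The order term and the
  block terms both yield the order divided by \<open>2 * q\<close>, which add up to a multiple of
  \<open>1 / q\<close>.\<close>

lemma trace_filler: "gadget_trace (2 * q - 1) (\<lambda>_. 1) ((\<lambda>j. if j = 0 then f else 0)) =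
    (2 * real q - 1 + real f) / real q + real f"
proof -
  have m: "clique_order (2 * q - 1) (\<lambda>_. 1) = 2 * real q"
    using q by (simp add: clique_order_def of_nat_diff)
  have "gadget_trace (2 * q - 1) (\<lambda>_. 1) ((\<lambda>j. if j = 0 then f else 0)) =
      (2 * real q - 1 + real f) / (2 * real q) +
      (\<Sum>j<2 * q - 1. (1 + real (if j = 0 then f else 0)) / (2 * real q) + real (if j = 0 then f else 0))"
    unfolding gadget_trace_def Let_def order_filler m by simp
  also have "(\<Sum>j<2 * q - 1. (1 + real (if j = 0 then f else 0)) / (2 * real q) + real (if j = 0 then f else 0)) =
      (2 * real q - 1 + real f) / (2 * real q) + real f"
    unfolding sum.distrib sum_divide_distrib[symmetric] sum_filler_leaves using q by (simp add: of_nat_diff)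
  finally show ?thesis by (simp add: field_simps)
qed

lemma card_V: "real (card V) = 1 + real k * (3 * (2 * real s + 1)) + (2 * real q - 1 + real f) + real a + real l"
  unfolding card_S sum_gadgets[of gadget_order] order_filler
  by (simp add: gadget_order_def sum_lessThan_3)

lemma trace_balanced:
  "(\<Sum>c<k + 1 + a. gadget_trace (J c) (t c) (b c)) + (\<Sum>i<l. real i + 1) =
     (real (card V) - 1) * gain s + loss s"
proof -
  have leaf: "gadget_trace 1 (\<lambda>_. 1) (\<lambda>_. 0) = 1"
    by (simp add: gadget_trace_def gadget_order_def clique_order_def)
  have "(\<Sum>i<l. real i + 1) = real l * (real l + 1) / 2"
    by (induction l) (simp_all add: field_simps)
  then show ?thesis
    unfolding sum_gadgets[of gadget_trace] trace_filler leaf card_V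
    using balance unfolding excess_def by (simp add: algebra_simps)
qed

lemma good_Mid:
  assumes "c < k" "j < 3" "i < s + 1"
  shows "to_nat (Mid c j i) \<in> good_vertices (induced adj V)"
proof -
  have J: "J c = 3" "t c = (\<lambda>_. s + 1)" "b c = (\<lambda>_. s)" using assms by (simp_all add: J_def t_def b_def)
  have v: "Mid c j i \<in> V" using assms J by (auto simp: V_def full_gadgets_def)
  have t2: "t c j \<ge> 2" using J s by simp
  have "Digraph_Component.connected (induced adj (V - {Mid c j i}))"
    by (rule gadget_graph.connected[OF delete_Mid[OF v t2]])
  moreover have "kirchhoff_index (induced adj V) = kirchhoff_index (induced adj (V - {Mid c j i}))"
    using kirchhoff_index_delete_Mid[OF v t2] gadget_modified_block(1,2)[OF assms(2), of s]
    unfolding trace_balanced J by (simp add: gain_def loss_def)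
  ultimately show ?thesis
    using v by (simp add: good_vertices_def del_vert_induced)
qed

text \<open>Deleting an outer vertex lowers the trace by \<open>d > 0\<close>. In a balanced graph
  the Kirchhoff index then drops by \<open>(n - 1) * (gain s + d) + loss s - d'\<close>. As
  \<open>k \<ge> 1\<close> gives \<open>n - 1 \<ge> 3 * (2 * s + 1)\<close>, this is
  positive.\<close>

lemma not_good_Out:
  assumes "c < k" "j < 3" "i < s"
  shows "to_nat (Out c j i) \<notin> good_vertices (induced adj V)"
proof -
  have J: "J c = 3" "t c = (\<lambda>_. s + 1)" "b c = (\<lambda>_. s)" using assms by (simp_all add: J_def t_def b_def)
  have v: "Out c j i \<in> V" using assms J by (auto simp: V_def full_gadgets_def)
  define d where "d = gadget_trace 3 (\<lambda>_. s + 1) (\<lambda>_. s) - gadget_trace 3 (\<lambda>_. s + 1) ((\<lambda>_. s)(0 := s - 1))"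
  define d' where "d' = gadget_sum 3 (\<lambda>_. s + 1) (\<lambda>_. s) - gadget_sum 3 (\<lambda>_. s + 1) ((\<lambda>_. s)(0 := s - 1))"
  note pos = gadget_estimates_pos[OF s, folded d_def d'_def]
  have "real k * (3 * (2 * real s + 1)) \<ge> 1 * (3 * (2 * real s + 1))"
    using k by (intro mult_right_mono) auto
  moreover have "real q \<ge> 1" using q by simp
  ultimately have n: "real (card V) - 1 \<ge> 3 * (2 * real s + 1)"
    unfolding card_V by linarith
  have "kirchhoff_index (induced adj V) - kirchhoff_index (induced adj (V - {Out c j i})) =
      (real (card V) - 1) * gain s + loss s + (real (card V) - 1) * d - d'"
    using kirchhoff_index_delete_Out[OF v] gadget_modified_block(3,4)[OF assms(2), of s]
    unfolding trace_balanced J d_def d'_def by (simp add: algebra_simps)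
  also have "\<dots> > 0"
  proof -
    have "(real (card V) - 1) * d \<ge> 3 * (2 * real s + 1) * d"
      using n pos(3) by (intro mult_right_mono) auto
    moreover have "(real (card V) - 1) * gain s \<ge> 0"
      using n pos(1) by (intro mult_nonneg_nonneg) auto
    ultimately show ?thesis using pos(4) by linarith
  qed
  finally show ?thesis
    by (simp add: good_vertices_def del_vert_induced)
qed

lemma graph_V: "Digraph.graph (induced adj V)"
  by (rule graph_induced[OF finite_S symp_adj irreflp_adj])

lemma card_verts: "card (verts (induced adj V)) = card V"
  by (simp add: card_image inj_on_subset[OF inj_to_nat])

text \<open>The status of the hub, the path, the filler and the leaves is left open. Two-sided
  bounds suffice, because these vertices are negligible in the limit.\<close>

lemma card_good_vertices:
  "3 * k * (s + 1) \<le> card (good_vertices (induced adj V))"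
  "card (good_vertices (induced adj V)) + 3 * k * s \<le> card V"
proof -
  define B where "B r = {..<k} \<times> {..<3::nat} \<times> {..<r::nat}" for r
  have card_B: "card (B r) = 3 * k * r" "finite (B r)" for r by (simp_all add: B_def card_cartesian_product)
  define M where "M = (\<lambda>(c, j, i). to_nat (Mid c j i)) ` B (s + 1)"
  define W where "W = (\<lambda>(c, j, i). to_nat (Out c j i)) ` B s"
  have cards: "card M = 3 * k * (s + 1)" "card W = 3 * k * s"
    unfolding M_def W_def by (subst card_image; auto simp: inj_on_def card_B)+
  have fin: "finite (good_vertices (induced adj V))"
    by (rule finite_subset[of _ "to_nat ` V"]) (auto simp: good_vertices_def)
  have "M \<subseteq> good_vertices (induced adj V)"
    using good_Mid by (auto simp: M_def B_def)
  from card_mono[OF fin this] show "3 * k * (s + 1) \<le> card (good_vertices (induced adj V))"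
    by (simp add: cards)
  have disj: "good_vertices (induced adj V) \<inter> W = {}"
    using not_good_Out by (auto simp: W_def B_def)
  have "Out c j i \<in> V" if "(c, j, i) \<in> B s" for c j i
    using that by (auto simp: B_def V_def full_gadgets_def J_def b_def)
  then have "good_vertices (induced adj V) \<union> W \<subseteq> to_nat ` V"
    by (auto simp: good_vertices_def W_def)
  then have "card (good_vertices (induced adj V) \<union> W) \<le> card (to_nat ` V)"
    by (intro card_mono) auto
  also have "card (good_vertices (induced adj V) \<union> W) = card (good_vertices (induced adj V)) + card W"
    using fin disj by (intro card_Un_disjoint) (auto simp: W_def card_B)
  finally show "card (good_vertices (induced adj V)) + 3 * k * s \<le> card V"
    by (simp add: cards card_image inj_on_subset[OF inj_to_nat])
qed

end

section \<open>The infinite family and its limit\<close>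

lemma card_verts_iso:
  assumes "digraph_iso G H"
  shows "card (verts G) = card (verts H)"
  using assms by (auto simp: digraph_iso_def pre_digraph.digraph_isomorphism_def card_image)

theorem corollary16:
  fixes s :: nat
  assumes "s \<ge> 1"
  shows "\<exists>\<Gamma> :: nat \<Rightarrow> (nat, nat \<times> nat) pre_digraph.
    (\<forall>k\<ge>1. Digraph.graph (\<Gamma> k) \<and> Digraph_Component.connected (\<Gamma> k)) \<and>
    (\<forall>k\<ge>1. \<forall>l\<ge>1. k \<noteq> l \<longrightarrow> \<not> digraph_iso (\<Gamma> k) (\<Gamma> l)) \<and>
    (\<lambda>k. real (card (good_vertices (\<Gamma> k))) / real (card (verts (\<Gamma> k))))
      \<longlonglongrightarrow> (real s + 1) / (2 * real s + 1) \<and>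
    (s = 1 \<longrightarrow>
       (\<lambda>k. real (card (good_vertices (\<Gamma> k))) / real (card (verts (\<Gamma> k)))) \<longlonglongrightarrow> 2 / 3)"
proof -
  have rats: "gain s \<in> \<rat>" "excess s \<in> \<rat>" "loss s \<in> \<rat>"
    unfolding gadget_estimates[OF assms] by simp_all
  obtain q and k l :: "nat \<Rightarrow> nat" and f a
    where q: "q \<ge> 1" and mono: "mono k" "strict_mono l" and k: "\<And>i. k i \<ge> 1"
    and bal: "\<And>i. real (k i) * excess s = (2 * real q - 1 + real f) / real q + real f
      - gain s * (2 * real q - 1 + real f) + real a * (1 - gain s)
      + real (l i) * (real (l i) + 1) / 2 - gain s * real (l i) - loss s"
    and small: "\<And>c. (\<lambda>i. (c + real (l i)) / real (k i)) \<longlonglongrightarrow> 0"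
    by (rule balancing_parameters[OF rats gadget_estimates_pos(2)[OF assms]]) (rule that)
  have fam: "balanced_family s q f a (k i) (l i)" for i
    using assms q k bal by unfold_locales auto
  define U where "U i = balanced_family.V s q f a (k i) (l i)" for i
  define \<Gamma> where "\<Gamma> i = induced adj (U i)" for i
  define n where "n i = card (U i)" for i
  define g where "g i = card (good_vertices (\<Gamma> i))" for i
  have conn: "Digraph.graph (\<Gamma> i)" "Digraph_Component.connected (\<Gamma> i)" for i
  proof -
    interpret balanced_family s q f a "k i" "l i" by (rule fam)
    show "Digraph.graph (\<Gamma> i)" "Digraph_Component.connected (\<Gamma> i)"
      unfolding \<Gamma>_def U_def by (rule graph_V connected)+
  qed
  have verts: "card (verts (\<Gamma> i)) = n i" for i
    unfolding \<Gamma>_def n_def U_def by (rule balanced_family.card_verts[OF fam])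
  define c where "c = 2 * real q + real f + real a"
  have n: "real (n i) = real (k i) * (3 * (2 * real s + 1)) + (c + real (l i))" for i
    unfolding n_def U_def balanced_family.card_V[OF fam] c_def by simp
  \<comment> \<open>The orders increase strictly because the path lengths do, so no two graphs of
    the family are isomorphic.\<close>
  have "n i < n i'" if "i < i'" for i i'
  proof -
    have "real (k i) * (3 * (2 * real s + 1)) \<le> real (k i') * (3 * (2 * real s + 1))"
      using monoD[OF mono(1), of i i'] that by (intro mult_right_mono) auto
    moreover have "real (l i) < real (l i')" using strict_monoD[OF mono(2) that] by simp
    ultimately have "real (n i) < real (n i')" unfolding n by linarith
    then show ?thesis by simp
  qed
  then have iso: "\<not> digraph_iso (\<Gamma> i) (\<Gamma> i')" if "i \<noteq> i'" for i i'
    using that card_verts_iso[of "\<Gamma> i" "\<Gamma> i'"] unfolding verts by (metis less_irrefl nat_neq_iff)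
  have bounds: "3 * k i * (s + 1) \<le> g i" "g i + 3 * k i * s \<le> n i" for i
    unfolding g_def n_def \<Gamma>_def U_def by (rule balanced_family.card_good_vertices[OF fam])+
  \<comment> \<open>\<open>c + l i\<close> counts all vertices outside the copies, so
    \<open>x i\<close> is their number per copy.\<close>
  define x where "x i = (c + real (l i)) / real (k i)" for i
  have x: "x \<longlonglongrightarrow> 0" unfolding x_def by (rule small)
  have x_ge: "x i \<ge> 0" for i by (simp add: x_def c_def)
  have kpos: "real (k i) > 0" for i using k[of i] by simp
  have nx: "real (n i) = real (k i) * (3 * (2 * real s + 1) + x i)" for i
    unfolding n x_def using kpos[of i] by (simp add: field_simps)
  have den: "3 * (2 * real s + 1) + x i > 0" for i using x_ge[of i] by simp
  have limit: "(\<lambda>i. real (g i) / real (n i)) \<longlonglongrightarrow> (real s + 1) / (2 * real s + 1)"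
  proof (rule real_tendsto_sandwich)
    \<comment> \<open>The lower bound counts only the middle vertices of the copies as good; the
      upper bound excludes only their outer vertices.\<close>
    have low: "3 * (real s + 1) / (3 * (2 * real s + 1) + x i) \<le> real (g i) / real (n i)" for i
    proof -
      have "3 * (real s + 1) / (3 * (2 * real s + 1) + x i) = real (3 * k i * (s + 1)) / real (n i)"
      proof -
        have "real (3 * k i * (s + 1)) = real (k i) * (3 * (real s + 1))" by (simp add: algebra_simps)
        then show ?thesis unfolding nx using kpos[of i] by (simp only: mult_divide_mult_cancel_left_if) simp
      qed
      also have "\<dots> \<le> real (g i) / real (n i)"
        using bounds(1)[of i] by (intro divide_right_mono) (simp_all only: of_nat_le_iff of_nat_0_le_iff)
      finally show ?thesis .
    qed
    then show "\<forall>\<^sub>F i in sequentially. 3 * (real s + 1) / (3 * (2 * real s + 1) + x i) \<le> real (g i) / real (n i)"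
      by simp
    have up: "real (g i) / real (n i) \<le> 1 - 3 * real s / (3 * (2 * real s + 1) + x i)" for i
    proof -
      have "real (g i) \<le> real (n i) - 3 * real (k i) * real s"
        using bounds(2)[of i, THEN of_nat_mono, where 'a = real] by simp
      then have "real (g i) / real (n i) \<le> (real (n i) - 3 * real (k i) * real s) / real (n i)"
        by (intro divide_right_mono) auto
      also have "\<dots> = 1 - 3 * real s / (3 * (2 * real s + 1) + x i)"
        unfolding nx diff_divide_distrib using kpos[of i] den[of i] by simp
      finally show ?thesis .
    qed
    then show "\<forall>\<^sub>F i in sequentially. real (g i) / real (n i) \<le> 1 - 3 * real s / (3 * (2 * real s + 1) + x i)"
      by simp
    have "(\<lambda>i. 3 * (real s + 1) / (3 * (2 * real s + 1) + x i)) \<longlonglongrightarrow> 3 * (real s + 1) / (3 * (2 * real s + 1) + 0)"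
      by (intro tendsto_intros x) auto
    then show "(\<lambda>i. 3 * (real s + 1) / (3 * (2 * real s + 1) + x i)) \<longlonglongrightarrow> (real s + 1) / (2 * real s + 1)"
      by (simp only: add_0_right mult_divide_mult_cancel_left_if) simp
    have "(\<lambda>i. 1 - 3 * real s / (3 * (2 * real s + 1) + x i)) \<longlonglongrightarrow> 1 - 3 * real s / (3 * (2 * real s + 1) + 0)"
      by (intro tendsto_intros x) auto
    moreover have "1 - 3 * real s / (3 * (2 * real s + 1) + 0) = (real s + 1) / (2 * real s + 1)"
      by (simp add: field_simps)
    ultimately show "(\<lambda>i. 1 - 3 * real s / (3 * (2 * real s + 1) + x i)) \<longlonglongrightarrow> (real s + 1) / (2 * real s + 1)"
      by simp
  qed
  show ?thesis
    by (rule exI[of _ \<Gamma>]) (use conn iso limit in \<open>auto simp: verts g_def\<close>)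
qed

end
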